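(* Let $G$ be a complex connected semisimple simply connected Lie group with Lie algebra $\mathfrak{g}$, Chevalley–Serre generators $\{h_i,e_i,f_i: i\in I\}$ and Cartan matrix $\|a_{ij}\|$. The group $W_G^U$ acts on $\mathfrak{g}$ via the homomorphism $W_G^U\to\widetilde U=U\rtimes\Gamma$ sending $\sigma_i\mapsto\varsigma_i:=e^{\frac{\imath\pi}{2}(e_i+f_i)}\gamma$ and $\bar\sigma_i\mapsto\bar\varsigma_i:=e^{-\frac{\imath\pi}{2}(e_i+f_i)}\gamma$ as follows: $$\mathrm{Ad}_{\varsigma_i}(\imath e_i)=-\imath f_i,\qquad \mathrm{Ad}_{\varsigma_i}(\imath f_i)=-\imath e_i,$$ $$\mathrm{Ad}_{\varsigma_i}(\imath e_j)=-\imath e_j,\qquad \mathrm{Ad}_{\varsigma_i}(\imath f_j)=-\imath f_j,\qquad\text{if } a_{ij}=0,$$ and, for all $i\ne j$, $$\mathrm{Ad}_{\varsigma_i}(\imath e_j)=-\frac{1}{|a_{ij}|!}\underbrace{\bigl[\imath e_i,[\ldots[\imath e_i}_{|a_{ij}|},\imath e_j]\ldots]\bigr],\qquad \mathrm{Ad}_{\varsigma_i}(\imath f_j)=-\frac{1}{|a_{ij}|!}\underbrace{\bigl[\imath f_i,[\ldots[\imath f_i}_{|a_{ij}|},\imath f_j]\ldots]\bigr].$$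
   Context: $I$ is the set of vertices of the Dynkin diagram of $\mathfrak{g}=\mathrm{Lie}(G)$, $a_{ij}=\langle\alpha_i^\vee,\alpha_j\rangle$, $\imath$ is the imaginary unit, and the generators satisfy: the $h_i$ commute, $[h_i,e_j]=a_{ij}e_j$, $[h_i,f_j]=-a_{ij}f_j$, $[e_i,f_j]=\delta_{ij}h_j$, and for $i\neq j$, $\mathrm{ad}_{e_i}^{1-a_{ij}}(e_j)=0$, $\mathrm{ad}_{f_i}^{1-a_{ij}}(f_j)=0$. The underbrace $|a_{ij}|$ denotes the $|a_{ij}|$-fold iterated commutator. The split real structure is the one for which all $h_i,e_i,f_i$ are real; complex conjugation on $\mathfrak{g}$ (antilinear) and on $G$ refers to it. The Cartan anti-involution $\top$ is the complex-linear anti-automorphism $e_i\mapsto f_i$, $f_i\mapsto e_i$, $h_i\mapsto h_i$; $g\mapsto g^\dagger$ is its composition with complex conjugation, and $U=\{g\in G: g^\dagger g=1\}$. $\Gamma=\mathrm{Gal}(\mathbb{C}/\mathbb{R})=\{1,\gamma\}$ acts on $G$ and $U$ by complex conjugation, $\widetilde U=U\rtimes\Gamma\subset\widetilde G=G\rtimes\Gamma$. In the adjoint action of $\widetilde G$ on $\mathfrak{g}$, $G$ acts by the usual $\mathrm{Ad}$ and $\gamma$ acts by the antilinear complex conjugation fixing all $h_i,e_i,f_i$ (so $\mathrm{Ad}_\gamma(\imath x)=-\imath\,\mathrm{Ad}_\gamma(x)$). $W_G^U$ is the group generated by $\{\sigma_i,\bar\sigma_i: i\in I\}$ subject to $\sigma_i^2=\bar\sigma_i^2=1$,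 $\sigma_i\bar\sigma_i=\bar\sigma_i\sigma_i$; and, for $i\neq j$, $\sigma_j\sigma_i\sigma_j=\bar\sigma_j\,\Pi^{1-a_{ji}}(\bar\sigma_i)\,\bar\sigma_j$ and $\underbrace{\sigma_i\sigma_j\sigma_i\cdots}_{m_{ij}}=\underbrace{\bar\sigma_j\bar\sigma_i\bar\sigma_j\cdots}_{m_{ij}}$, where $m_{ij}=2,3,4,6$ for $a_{ij}a_{ji}=0,1,2,3$ respectively, and $\Pi(\sigma_i)=\bar\sigma_i$, $\Pi(\bar\sigma_i)=\sigma_i$. The displayed assignment on generators does define a homomorphism $W_G^U\to\widetilde U$. *)

theory Defs
  imports "HOL-Analysis.Analysis" "HOL-Algebra.Group_Action"
begin

section \<open>Complex manifolds and complex Lie groups\<close>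

abbreviation clinear :: "(complex^'n \<Rightarrow> complex^'m) \<Rightarrow> bool" where
  "clinear \<equiv> Vector_Spaces.linear (*s) (*s)"

definition antilinear :: "(complex^'n \<Rightarrow> complex^'m) \<Rightarrow> bool" where
  "antilinear f \<longleftrightarrow> (\<forall>x y. f (x + y) = f x + f y) \<and> (\<forall>z x. f (z *s x) = cnj z *s f x)"

text \<open>Complex differentiability at a point, for one and for two vector variables; a map is
  holomorphic on an open set if it is complex differentiable at each of its points.\<close>

definition complex_differentiable_at :: "(complex^'n \<Rightarrow> complex^'m) \<Rightarrow> complex^'n \<Rightarrow> bool" where
  "complex_differentiable_at f x \<longleftrightarrow> (\<exists>D. clinear D \<and> (f has_derivative D) (at x))"

definition complex_differentiable2_at ::
    "((complex^'n) \<times> (complex^'m) \<Rightarrow> complex^'k) \<Rightarrow> (complex^'n) \<times> (complex^'m) \<Rightarrow> bool" where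
  "complex_differentiable2_at f p \<longleftrightarrow>
     (\<exists>D E. clinear D \<and> clinear E \<and> (f has_derivative (\<lambda>(u, v). D u + E v)) (at p))"

text \<open>A chart is a pair of its domain and the coordinate map.\<close>

type_synonym ('g, 'n) chart = "'g set \<times> ('g \<Rightarrow> complex^'n)"

definition chart_inv :: "('g, 'n) chart \<Rightarrow> complex^'n \<Rightarrow> 'g" where
  "chart_inv k = inv_into (fst k) (snd k)"

definition complex_manifold :: "'g::t2_space set \<Rightarrow> ('g, 'n::finite) chart set \<Rightarrow> bool" where
  "complex_manifold M A \<longleftrightarrow>
     second_countable (top_of_set M) \<and>
     (\<Union>k\<in>A. fst k) = M \<and>
     (\<forall>k\<in>A. openin (top_of_set M) (fst k) \<and> open (snd k ` fst k) \<and>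
        homeomorphism (fst k) (snd k ` fst k) (snd k) (chart_inv k)) \<and>
     (\<forall>k\<in>A. \<forall>l\<in>A. \<forall>x\<in>snd k ` (fst k \<inter> fst l).
        complex_differentiable_at (snd l \<circ> chart_inv k) x)"

definition complex_lie_group :: "('g::t2_space) monoid \<Rightarrow> ('g, 'n::finite) chart set \<Rightarrow> bool" where
  "complex_lie_group G A \<longleftrightarrow>
     group G \<and>
     complex_manifold (carrier G) A \<and>
     continuous_on (carrier G \<times> carrier G) (\<lambda>(x, y). x \<otimes>\<^bsub>G\<^esub> y) \<and>
     continuous_on (carrier G) (\<lambda>x. inv\<^bsub>G\<^esub> x) \<and>
     (\<forall>k\<in>A. \<forall>l\<in>A. \<forall>p\<in>A. \<forall>x\<in>snd k ` fst k. \<forall>y\<in>snd l ` fst l.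
        chart_inv k x \<otimes>\<^bsub>G\<^esub> chart_inv l y \<in> fst p \<longrightarrow>
        complex_differentiable2_at
          (\<lambda>(x, y). snd p (chart_inv k x \<otimes>\<^bsub>G\<^esub> chart_inv l y)) (x, y)) \<and>
     (\<forall>k\<in>A. \<forall>p\<in>A. \<forall>x\<in>snd k ` fst k.
        inv\<^bsub>G\<^esub> (chart_inv k x) \<in> fst p \<longrightarrow>
        complex_differentiable_at (\<lambda>x. snd p (inv\<^bsub>G\<^esub> (chart_inv k x))) x)"


section \<open>The Lie algebra, adjoint action and exponential map\<close>

text \<open>A chart \<open>k\<close> around the identity identifies the tangent space \<open>T\<^sub>1 G\<close>, that is the
  Lie algebra of \<open>G\<close>, with \<open>complex^'n\<close>. The operations below are those of the Lie algebra in this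
  identification.\<close>

definition differential_at_one ::
    "('g::t2_space) monoid \<Rightarrow> ('g, 'n::finite) chart \<Rightarrow> ('g \<Rightarrow> 'g) \<Rightarrow> (complex^'n \<Rightarrow> complex^'n) \<Rightarrow> bool"
  where
  "differential_at_one G k F D \<longleftrightarrow>
     ((\<lambda>x. snd k (F (chart_inv k x))) has_derivative D) (at (snd k \<one>\<^bsub>G\<^esub>))"

text \<open>\<open>Ad\<^sub>g\<close> is the differential at the identity of \<open>x \<mapsto> g x g\<^sup>-\<^sup>1\<close>, and
  \<open>[X, Y]\<close> is the differential at the identity, in direction \<open>X\<close>, of \<open>g \<mapsto> Ad\<^sub>g Y\<close>.\<close>

definition lie_Ad :: "('g::t2_space) monoid \<Rightarrow> ('g, 'n::finite) chart \<Rightarrow> 'g \<Rightarrow> complex^'n \<Rightarrow> complex^'n"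
  where
  "lie_Ad G k g =
     frechet_derivative (\<lambda>x. snd k (g \<otimes>\<^bsub>G\<^esub> chart_inv k x \<otimes>\<^bsub>G\<^esub> inv\<^bsub>G\<^esub> g)) (at (snd k \<one>\<^bsub>G\<^esub>))"

definition lie_bracket ::
    "('g::t2_space) monoid \<Rightarrow> ('g, 'n::finite) chart \<Rightarrow> complex^'n \<Rightarrow> complex^'n \<Rightarrow> complex^'n"
  where
  "lie_bracket G k X Y =
     frechet_derivative (\<lambda>x. lie_Ad G k (chart_inv k x) Y) (at (snd k \<one>\<^bsub>G\<^esub>)) X"

text \<open>The exponential map sends \<open>X\<close> to \<open>\<gamma>(1)\<close> for the one-parameter subgroup \<open>\<gamma>\<close> with
  velocity \<open>X\<close>; equivalently, \<open>t \<mapsto> exp (t X)\<close> is that one-parameter subgroup for every \<open>X\<close>.\<close>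

definition one_parameter_subgroup ::
    "('g::t2_space) monoid \<Rightarrow> ('g, 'n::finite) chart \<Rightarrow> complex^'n \<Rightarrow> (real \<Rightarrow> 'g) \<Rightarrow> bool" where
  "one_parameter_subgroup G k X \<gamma> \<longleftrightarrow>
     range \<gamma> \<subseteq> carrier G \<and>
     (\<forall>s t. \<gamma> (s + t) = \<gamma> s \<otimes>\<^bsub>G\<^esub> \<gamma> t) \<and>
     continuous_on UNIV \<gamma> \<and>
     ((\<lambda>t. snd k (\<gamma> t)) has_vector_derivative X) (at 0)"

definition is_lie_exp ::
    "('g::t2_space) monoid \<Rightarrow> ('g, 'n::finite) chart \<Rightarrow> (complex^'n \<Rightarrow> 'g) \<Rightarrow> bool" where
  "is_lie_exp G k Exp \<longleftrightarrow> (\<forall>X. one_parameter_subgroup G k X (\<lambda>t. Exp (t *\<^sub>R X)))"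


section \<open>Semisimple Lie algebras and Chevalley--Serre generators\<close>

definition semisimple_bracket :: "(complex^'n::finite \<Rightarrow> complex^'n \<Rightarrow> complex^'n) \<Rightarrow> bool" where
  "semisimple_bracket br \<longleftrightarrow>
     (\<forall>J. vec.subspace J \<and> (\<forall>X. \<forall>Y\<in>J. br X Y \<in> J) \<and> (\<forall>X\<in>J. \<forall>Y\<in>J. br X Y = 0) \<longrightarrow> J = {0})"

text \<open>Cartan matrices of finite type; the index type is the vertex set of the Dynkin diagram.\<close>

definition cartan_matrix :: "('i::finite \<Rightarrow> 'i \<Rightarrow> int) \<Rightarrow> bool" where
  "cartan_matrix a \<longleftrightarrow>
     (\<forall>i. a i i = 2) \<and>
     (\<forall>i j. i \<noteq> j \<longrightarrow> a i j \<le> 0) \<and>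
     (\<forall>i j. a i j = 0 \<longleftrightarrow> a j i = 0) \<and>
     (\<exists>d :: 'i \<Rightarrow> real. (\<forall>i. 0 < d i) \<and>
        (\<forall>i j. d i * of_int (a i j) = d j * of_int (a j i)) \<and>
        (\<forall>x. x \<noteq> (\<lambda>_. 0) \<longrightarrow> 0 < (\<Sum>i\<in>UNIV. \<Sum>j\<in>UNIV. d i * of_int (a i j) * x i * x j)))"

definition chevalley_serre_generators ::
    "(complex^'n::finite \<Rightarrow> complex^'n \<Rightarrow> complex^'n) \<Rightarrow> ('i::finite \<Rightarrow> 'i \<Rightarrow> int) \<Rightarrow>
     ('i \<Rightarrow> complex^'n) \<Rightarrow> ('i \<Rightarrow> complex^'n) \<Rightarrow> ('i \<Rightarrow> complex^'n) \<Rightarrow> bool" where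
  "chevalley_serre_generators br a h e f \<longleftrightarrow>
     inj h \<and> vec.independent (range h) \<and>
     (\<forall>S. vec.subspace S \<and> (\<forall>X\<in>S. \<forall>Y\<in>S. br X Y \<in> S) \<and> range h \<union> range e \<union> range f \<subseteq> S
        \<longrightarrow> S = UNIV) \<and>
     (\<forall>i j. br (h i) (h j) = 0) \<and>
     (\<forall>i j. br (h i) (e j) = of_int (a i j) *s e j) \<and>
     (\<forall>i j. br (h i) (f j) = - (of_int (a i j) *s f j)) \<and>
     (\<forall>i j. br (e i) (f j) = (if i = j then h i else 0)) \<and>
     (\<forall>i j. i \<noteq> j \<longrightarrow> (br (e i) ^^ nat (1 - a i j)) (e j) = 0) \<and>
     (\<forall>i j. i \<noteq> j \<longrightarrow> (br (f i) ^^ nat (1 - a i j)) (f j) = 0)"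


section \<open>Complex conjugation, Cartan anti-involution and compact form\<close>

definition split_conjugation ::
    "(complex^'n::finite \<Rightarrow> complex^'n \<Rightarrow> complex^'n) \<Rightarrow>
     ('i \<Rightarrow> complex^'n) \<Rightarrow> ('i \<Rightarrow> complex^'n) \<Rightarrow> ('i \<Rightarrow> complex^'n) \<Rightarrow>
     (complex^'n \<Rightarrow> complex^'n) \<Rightarrow> bool" where
  "split_conjugation br h e f cj \<longleftrightarrow>
     antilinear cj \<and> (\<forall>X Y. cj (br X Y) = br (cj X) (cj Y)) \<and>
     (\<forall>i. cj (h i) = h i \<and> cj (e i) = e i \<and> cj (f i) = f i)"

definition cartan_anti_involution ::
    "(complex^'n::finite \<Rightarrow> complex^'n \<Rightarrow> complex^'n) \<Rightarrow>
     ('i \<Rightarrow> complex^'n) \<Rightarrow> ('i \<Rightarrow> complex^'n) \<Rightarrow> ('i \<Rightarrow> complex^'n) \<Rightarrow>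
     (complex^'n \<Rightarrow> complex^'n) \<Rightarrow> bool" where
  "cartan_anti_involution br h e f tp \<longleftrightarrow>
     clinear tp \<and> (\<forall>X Y. tp (br X Y) = br (tp Y) (tp X)) \<and>
     (\<forall>i. tp (h i) = h i \<and> tp (e i) = f i \<and> tp (f i) = e i)"

text \<open>A (anti-)automorphism of the Lie algebra is carried over to \<open>G\<close> as the (anti-)automorphism
  of \<open>G\<close> with that differential at the identity. For connected \<open>G\<close> it is unique, and for simply
  connected \<open>G\<close> it exists.\<close>

definition integrates_automorphism ::
    "('g::t2_space) monoid \<Rightarrow> ('g, 'n::finite) chart \<Rightarrow> (complex^'n \<Rightarrow> complex^'n) \<Rightarrow> ('g \<Rightarrow> 'g) \<Rightarrow> bool"
  where
  "integrates_automorphism G k D F \<longleftrightarrow>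
     F \<in> iso G G \<and> continuous_on (carrier G) F \<and> differential_at_one G k F D"

definition integrates_anti_automorphism ::
    "('g::t2_space) monoid \<Rightarrow> ('g, 'n::finite) chart \<Rightarrow> (complex^'n \<Rightarrow> complex^'n) \<Rightarrow> ('g \<Rightarrow> 'g) \<Rightarrow> bool"
  where
  "integrates_anti_automorphism G k D F \<longleftrightarrow>
     bij_betw F (carrier G) (carrier G) \<and>
     (\<forall>x\<in>carrier G. \<forall>y\<in>carrier G. F (x \<otimes>\<^bsub>G\<^esub> y) = F y \<otimes>\<^bsub>G\<^esub> F x) \<and>
     continuous_on (carrier G) F \<and> differential_at_one G k F D"

definition compact_form :: "'g monoid \<Rightarrow> ('g \<Rightarrow> 'g) \<Rightarrow> ('g \<Rightarrow> 'g) \<Rightarrow> 'g monoid" where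
  "compact_form G cjG tpG =
     G\<lparr>carrier := {g \<in> carrier G. tpG (cjG g) \<otimes>\<^bsub>G\<^esub> g = \<one>\<^bsub>G\<^esub>}\<rparr>"


section \<open>Semidirect product with the Galois group\<close>

text \<open>\<open>Gal(\<complex>/\<real>)\<close> is realised literally as \<open>{id, cnj}\<close> under composition, so \<open>\<gamma>\<close> is \<open>cnj\<close>.
  The parameter \<open>c\<close> is the complex conjugation on the space acted upon.\<close>

definition galois_act :: "('x \<Rightarrow> 'x) \<Rightarrow> (complex \<Rightarrow> complex) \<Rightarrow> 'x \<Rightarrow> 'x" where
  "galois_act c s = (if s = cnj then c else id)"

definition galois_semidirect :: "'g monoid \<Rightarrow> ('g \<Rightarrow> 'g) \<Rightarrow> ('g \<times> (complex \<Rightarrow> complex)) monoid" where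
  "galois_semidirect G cjG =
     \<lparr>carrier = carrier G \<times> {id, cnj},
      monoid.mult = (\<lambda>(g, s) (g', t). (g \<otimes>\<^bsub>G\<^esub> galois_act cjG s g', s \<circ> t)),
      one = (\<one>\<^bsub>G\<^esub>, id)\<rparr>"

definition Ad_tilde ::
    "('g::t2_space) monoid \<Rightarrow> ('g, 'n::finite) chart \<Rightarrow> (complex^'n \<Rightarrow> complex^'n) \<Rightarrow>
     'g \<times> (complex \<Rightarrow> complex) \<Rightarrow> complex^'n \<Rightarrow> complex^'n" where
  "Ad_tilde G k cj w = lie_Ad G k (fst w) \<circ> galois_act cj (snd w)"

definition varsigma ::
    "(complex^'n \<Rightarrow> 'g) \<Rightarrow> ('i \<Rightarrow> complex^'n) \<Rightarrow> ('i \<Rightarrow> complex^'n) \<Rightarrow> 'i \<Rightarrow> 'g \<times> (complex \<Rightarrow> complex)" where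
  "varsigma Exp e f i = (Exp ((\<i> * of_real pi / 2) *s (e i + f i)), cnj)"

definition varsigma_bar ::
    "(complex^'n \<Rightarrow> 'g) \<Rightarrow> ('i \<Rightarrow> complex^'n) \<Rightarrow> ('i \<Rightarrow> complex^'n) \<Rightarrow> 'i \<Rightarrow> 'g \<times> (complex \<Rightarrow> complex)" where
  "varsigma_bar Exp e f i = (Exp ((- (\<i> * of_real pi / 2)) *s (e i + f i)), cnj)"


section \<open>Groups given by generators and relations\<close>

text \<open>A letter \<open>(s, False)\<close> stands for the generator \<open>s\<close> and \<open>(s, True)\<close> for its formal inverse.
  All elements of the type \<open>'s\<close> are generators.\<close>

type_synonym 's gword = "('s \<times> bool) list"

definition pos_word :: "'s list \<Rightarrow> 's gword" where
  "pos_word = map (\<lambda>s. (s, False))"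

inductive word_equiv :: "('s list \<times> 's list) set \<Rightarrow> 's gword \<Rightarrow> 's gword \<Rightarrow> bool" for R where
  we_rel: "(u, v) \<in> R \<Longrightarrow> word_equiv R (pos_word u) (pos_word v)"
| we_cancel: "word_equiv R [(s, b), (s, \<not> b)] []"
| we_refl: "word_equiv R u u"
| we_sym: "word_equiv R u v \<Longrightarrow> word_equiv R v u"
| we_trans: "word_equiv R u v \<Longrightarrow> word_equiv R v w \<Longrightarrow> word_equiv R u w"
| we_context: "word_equiv R u v \<Longrightarrow> word_equiv R (p @ u @ q) (p @ v @ q)"

definition word_class :: "('s list \<times> 's list) set \<Rightarrow> 's gword \<Rightarrow> 's gword set" where
  "word_class R u = {v. word_equiv R u v}"

definition presented_group :: "('s list \<times> 's list) set \<Rightarrow> 's gword set monoid" where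
  "presented_group R =
     \<lparr>carrier = range (word_class R),
      monoid.mult = (\<lambda>A B. {w. \<exists>u\<in>A. \<exists>v\<in>B. word_equiv R (u @ v) w}),
      one = word_class R []\<rparr>"


section \<open>The group \<open>W\<^sub>G\<^sup>U\<close>\<close>

datatype 'i wgen = Sig 'i | SigBar 'i

fun wbar :: "'i wgen \<Rightarrow> 'i wgen" where
  "wbar (Sig i) = SigBar i"
| "wbar (SigBar i) = Sig i"

fun alternating :: "nat \<Rightarrow> 's \<Rightarrow> 's \<Rightarrow> 's list" where
  "alternating 0 x y = []"
| "alternating (Suc n) x y = x # alternating n y x"

definition coxeter_exponent :: "('i \<Rightarrow> 'i \<Rightarrow> int) \<Rightarrow> 'i \<Rightarrow> 'i \<Rightarrow> nat" where
  "coxeter_exponent a i j =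
     (let p = a i j * a j i in if p = 0 then 2 else if p = 1 then 3 else if p = 2 then 4 else 6)"

definition wgu_relations :: "('i \<Rightarrow> 'i \<Rightarrow> int) \<Rightarrow> ('i wgen list \<times> 'i wgen list) set" where
  "wgu_relations a =
     {([Sig i, Sig i], []) | i. True} \<union>
     {([SigBar i, SigBar i], []) | i. True} \<union>
     {([Sig i, SigBar i], [SigBar i, Sig i]) | i. True} \<union>
     {([Sig j, Sig i, Sig j],
       [SigBar j, (wbar ^^ nat (1 - a j i)) (SigBar i), SigBar j]) | i j. i \<noteq> j} \<union>
     {(alternating (coxeter_exponent a i j) (Sig i) (Sig j),
       alternating (coxeter_exponent a i j) (SigBar j) (SigBar i)) | i j. i \<noteq> j}"

definition WGU :: "('i \<Rightarrow> 'i \<Rightarrow> int) \<Rightarrow> 'i wgen gword set monoid" where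
  "WGU a = presented_group (wgu_relations a)"

definition wgu_gen :: "('i \<Rightarrow> 'i \<Rightarrow> int) \<Rightarrow> 'i wgen \<Rightarrow> 'i wgen gword set" where
  "wgu_gen a s = word_class (wgu_relations a) (pos_word [s])"

end

theory Submission
  imports Defs "HOL-Complex_Analysis.Cauchy_Integral_Formula"
begin

text \<open>The adjoint representation is treated through one-parameter subgroups: \<open>Ad (exp (t X)) Y\<close> solves
  \<open>u' = [X, u]\<close>, \<open>Ad\<close> acts by Lie algebra automorphisms, and differentiating this along \<open>exp (t Z)\<close>
  gives the Jacobi identity. If \<open>v\<close> is a lowest weight vector of weight \<open>-m\<close> for an \<open>sl\<^sub>2\<close>-triple, the
  equation with \<open>X = (\<i> \<pi> / 2) (e + f)\<close> has an explicit solution starting at \<open>v\<close>, which ends at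
  \<open>\<i>\<^sup>m / m! ad\<^sub>e\<^sup>m v\<close>. The formulas are the instances \<open>v = e\<^sub>j\<close> for the triple \<open>(e\<^sub>i, f\<^sub>i, h\<^sub>i)\<close> and
  \<open>v = f\<^sub>j\<close> for \<open>(f\<^sub>i, e\<^sub>i, -h\<^sub>i)\<close>, together with \<open>v = f\<^sub>i\<close> and \<open>v = e\<^sub>i\<close>, where \<open>m = 2\<close>.

  The group operations are only assumed to be complex differentiable at each point. That \<open>Ad\<close> is
  differentiable at \<open>1\<close>, without which the bracket would be a junk value, therefore needs an argument
  in the style of Osgood based on Cauchy estimates.\<close>

section \<open>Partial derivatives of holomorphic maps in several variables\<close>

lemma scaleR_vector: "r *\<^sub>R (X :: complex^'n) = of_real r *s X"
  by (simp add: vec_eq_iff scaleR_conv_of_real[where 'a=complex])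

lemma bounded_linear_vector_scalar_mult: "bounded_linear (\<lambda>z::complex. z *s (w :: complex^'n))"
  by (intro linear_conv_bounded_linear[THEN iffD1] linearI)
     (auto simp: vec_eq_iff algebra_simps)

lemma bounded_linear_vector_scale: "bounded_linear (\<lambda>Y :: complex^'n. z *s Y)"
  by (intro linear_conv_bounded_linear[THEN iffD1] linearI)
     (auto simp: vec_eq_iff algebra_simps)

text \<open>Cauchy's inequality on circles of radius \<open>\<rho> / 3\<close> about points of
  \<open>cball 0 (\<rho> / 3)\<close>, which stay inside \<open>ball 0 \<rho>\<close>, bounds the
  second derivative by \<open>2 * M / (\<rho> / 3)^2\<close>, whence the 18. First-order Taylor
  expansion does the rest.\<close>

lemma cauchy_quadratic_bound:
  fixes \<phi> :: "complex \<Rightarrow> complex"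
  assumes hol: "\<phi> holomorphic_on ball 0 \<rho>" and bd: "\<And>z. z \<in> ball 0 \<rho> \<Longrightarrow> norm (\<phi> z) \<le> M"
    and z: "norm z \<le> \<rho> / 3" and \<rho>: "\<rho> > 0"
  shows "norm (\<phi> z - \<phi> 0 - deriv \<phi> 0 * z) \<le> 18 * M / \<rho>\<^sup>2 * (norm z)\<^sup>2"
proof -
  have der: "(deriv \<phi> has_field_derivative deriv (deriv \<phi>) x) (at x within cball 0 (\<rho>/3))"
    "(\<phi> has_field_derivative deriv \<phi> x) (at x within cball 0 (\<rho>/3))"
    if "x \<in> cball 0 (\<rho>/3)" for x
    using that \<rho> holomorphic_derivI[OF hol] holomorphic_derivI[OF holomorphic_deriv[OF hol]]
    by auto
  have 2: "norm (deriv (deriv \<phi>) x) \<le> 18 * M / \<rho>\<^sup>2" if "x \<in> cball 0 (\<rho>/3)" for x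
  proof -
    have sub: "cball x (\<rho>/3) \<subseteq> ball 0 \<rho>"
    proof
      fix y assume "y \<in> cball x (\<rho>/3)"
      then have "norm y \<le> norm x + \<rho>/3"
        using norm_triangle_ineq2[of y x] by (simp add: dist_norm norm_minus_commute)
      then show "y \<in> ball 0 \<rho>" using that \<rho> by simp
    qed
    have "norm ((deriv ^^ 2) \<phi> x) \<le> fact 2 * M / (\<rho>/3)^2"
    proof (rule Cauchy_inequality)
      show "\<phi> holomorphic_on ball x (\<rho>/3)"
        using hol sub by (meson ball_subset_cball holomorphic_on_subset subset_trans)
      show "continuous_on (cball x (\<rho>/3)) \<phi>"
        using hol sub by (meson holomorphic_on_imp_continuous_on holomorphic_on_subset)
      show "norm (\<phi> y) \<le> M" if "norm (x - y) = \<rho>/3" for y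
        using sub that bd by (auto simp: subset_iff dist_norm)
    qed (use \<rho> in auto)
    then show ?thesis by (simp add: numeral_2_eq_2 power_divide field_simps)
  qed
  have "norm ((deriv ^^ 0) \<phi> z - (\<Sum>i\<le>1. (deriv ^^ i) \<phi> 0 * (z - 0) ^ i / fact i))
      \<le> 18 * M / \<rho>\<^sup>2 * norm (z - 0) ^ Suc 1 / fact 1"
  proof (rule complex_Taylor[of "cball 0 (\<rho>/3)" 1 "\<lambda>i. (deriv ^^ i) \<phi>"])
    show "((deriv ^^ i) \<phi> has_field_derivative (deriv ^^ Suc i) \<phi> x) (at x within cball 0 (\<rho> / 3))"
      if "x \<in> cball 0 (\<rho>/3)" "i \<le> 1" for i x
      using that der[of x] by (cases i) auto
    show "norm ((deriv ^^ Suc 1) \<phi> x) \<le> 18 * M / \<rho>\<^sup>2" if "x \<in> cball 0 (\<rho>/3)" for x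
      using 2[OF that] by simp
  qed (use \<rho> z in auto)
  then show ?thesis by (simp add: algebra_simps power2_eq_square)
qed

text \<open>Complex linearity of the derivative makes the restriction to a complex line holomorphic,
  which gives access to one-variable estimates.\<close>

lemma complex_differentiable_at_line:
  fixes f :: "complex^'n::finite \<Rightarrow> complex^'m::finite"
  assumes "complex_differentiable_at f (c + \<zeta> *s w)"
  shows "\<exists>d. ((\<lambda>\<zeta>. f (c + \<zeta> *s w) $ i) has_field_derivative d) (at \<zeta>)"
proof -
  obtain D where D: "clinear D" "(f has_derivative D) (at (c + \<zeta> *s w))"
    using assms unfolding complex_differentiable_at_def by blast
  have "((\<lambda>\<zeta>. c + \<zeta> *s w) has_derivative (\<lambda>z. z *s w)) (at \<zeta>)"
    using bounded_linear_imp_has_derivative[OF bounded_linear_vector_scalar_mult[of w]]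
    by (auto intro!: derivative_eq_intros)
  from has_derivative_compose[OF this D(2)]
  have "((\<lambda>\<zeta>. f (c + \<zeta> *s w) $ i) has_derivative (\<lambda>z. D (z *s w) $ i)) (at \<zeta>)"
    by (rule bounded_linear.has_derivative[OF bounded_linear_vec_nth])
  moreover have "(\<lambda>z. D (z *s w) $ i) = (*) (D w $ i)"
    using D(1) by (auto simp: Vector_Spaces.linear_iff)
  ultimately show ?thesis unfolding has_field_derivative_def by auto
qed

text \<open>Each coordinate of \<open>z \<mapsto> f (c + z w)\<close> is holomorphic on the disc of
  radius \<open>R / norm w\<close>, and the one-variable estimate is used at \<open>z = 1\<close>.
  The constant depends on \<open>f\<close> only through \<open>M\<close>, so it is uniform over
  bounded families.\<close>

lemma complex_differentiable_quadratic_bound: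
  fixes f :: "complex^'n::finite \<Rightarrow> complex^'m::finite"
  assumes cd: "\<And>x. x \<in> ball c R \<Longrightarrow> complex_differentiable_at f x"
    and bd: "\<And>x. x \<in> ball c R \<Longrightarrow> norm (f x) \<le> M"
    and D: "(f has_derivative D) (at c)" and w: "norm w \<le> R / 3" and R: "R > 0"
  shows "norm (f (c + w) - f c - D w) \<le> of_nat CARD('m) * (18 * M / R\<^sup>2) * (norm w)\<^sup>2"
proof (cases "w = 0")
  case True
  then show ?thesis using linear_0[OF has_derivative_linear[OF D]] by simp
next
  case False
  define \<rho> where "\<rho> = R / norm w"
  have \<rho>: "\<rho> > 0" "\<rho> / 3 \<ge> 1" using False w R by (auto simp: \<rho>_def field_simps)
  have inb: "c + z *s w \<in> ball c R" if "z \<in> ball 0 \<rho>" for z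
  proof -
    have "norm (z *s w) = norm z * norm w"
      unfolding norm_vec_def by (simp add: norm_mult L2_set_right_distrib)
    then show ?thesis using that False by (simp add: \<rho>_def dist_norm field_simps)
  qed
  have "norm ((f (c + w) - f c - D w) $ i) \<le> 18 * M / R\<^sup>2 * (norm w)\<^sup>2" for i
  proof -
    define \<phi> where "\<phi> = (\<lambda>z. f (c + z *s w) $ i)"
    have "\<phi> field_differentiable at z" if "z \<in> ball 0 \<rho>" for z
      using complex_differentiable_at_line[OF cd[OF inb[OF that]]]
      unfolding \<phi>_def field_differentiable_def by blast
    then have hol: "\<phi> holomorphic_on ball 0 \<rho>"
      by (simp add: field_differentiable_at_within holomorphic_on_def)
    have "norm (\<phi> z) \<le> M" if "z \<in> ball 0 \<rho>" for z
      using bd[OF inb[OF that]] Finite_Cartesian_Product.norm_nth_le order_trans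
      unfolding \<phi>_def by blast
    from cauchy_quadratic_bound[OF hol this, of 1]
    have b: "norm (\<phi> 1 - \<phi> 0 - deriv \<phi> 0) \<le> 18 * M / \<rho>\<^sup>2" using \<rho> by simp
    \<comment> \<open>\<open>D\<close> is given only as a real derivative, so it is matched with
      \<open>deriv \<phi> 0\<close> along real \<open>t\<close>.\<close>
    have "((\<lambda>t::real. c + t *\<^sub>R w) has_derivative (\<lambda>t. t *\<^sub>R w)) (at 0)"
      by (auto intro!: derivative_eq_intros)
    from has_derivative_compose[OF this, of f D] D
    have "((\<lambda>t::real. f (c + t *\<^sub>R w) $ i) has_derivative (\<lambda>t. D (t *\<^sub>R w) $ i)) (at 0)"
      by (intro bounded_linear.has_derivative[OF bounded_linear_vec_nth]) simp
    then have "((\<lambda>t::real. f (c + t *\<^sub>R w) $ i) has_vector_derivative D w $ i) (at 0)"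
      by (simp add: has_vector_derivative_def linear_scale[OF has_derivative_linear[OF D]])
    moreover have "(\<phi> has_field_derivative deriv \<phi> 0) (at (of_real 0))"
      using holomorphic_derivI[OF hol] \<rho> by simp
    from has_vector_derivative_real_field[OF this]
    have "((\<lambda>t::real. \<phi> (of_real t)) has_vector_derivative deriv \<phi> 0) (at 0)" by simp
    moreover have "(\<lambda>t::real. f (c + t *\<^sub>R w) $ i) = (\<lambda>t::real. \<phi> (of_real t))"
    proof
      fix t :: real
      show "f (c + t *\<^sub>R w) $ i = \<phi> (of_real t)" by (simp add: \<phi>_def scaleR_vector)
    qed
    ultimately have "deriv \<phi> 0 = D w $ i"
      by (metis vector_derivative_unique_at)
    then show ?thesis using b by (simp add: \<phi>_def \<rho>_def power_divide)
  qed
  then have "(\<Sum>i\<in>UNIV. norm ((f (c + w) - f c - D w) $ i))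
      \<le> (\<Sum>i\<in>(UNIV::'m set). 18 * M / R\<^sup>2 * (norm w)\<^sup>2)"
    by (intro sum_mono)
  moreover have "norm (f (c + w) - f c - D w) \<le> (\<Sum>i\<in>UNIV. norm ((f (c + w) - f c - D w) $ i))"
    unfolding norm_vec_def by (intro L2_set_le_sum) simp
  ultimately show ?thesis by simp
qed

text \<open>Comparing the expansions at \<open>a + t w\<close> for small \<open>t\<close> shows that the derivatives converge,
  so pointwise convergence of the functions is enough.\<close>

lemma has_derivative_pointwise_limit:
  fixes g :: "'a::euclidean_space \<Rightarrow> 'b::banach"
  assumes lin: "\<And>m. linear (D m)"
    and bd: "\<And>m w. norm w \<le> \<rho> \<Longrightarrow> norm (gs m (a + w) - gs m a - D m w) \<le> K * (norm w)\<^sup>2"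
    and lim: "\<And>w. norm w \<le> \<rho> \<Longrightarrow> (\<lambda>m. gs m (a + w)) \<longlonglongrightarrow> g (a + w)" and \<rho>: "\<rho> > 0"
  shows "g differentiable (at a)"
proof -
  have K: "K \<ge> 0"
  proof -
    obtain b :: 'a where "b \<in> Basis" using nonempty_Basis by blast
    then have "norm (\<rho> *\<^sub>R b) \<le> \<rho>" and "b \<noteq> 0" using \<rho> by auto
    from bd[OF this(1)] have "0 \<le> K * (norm (\<rho> *\<^sub>R b))\<^sup>2" by (metis norm_ge_zero order_trans)
    then show ?thesis using \<open>b \<noteq> 0\<close> \<rho> by (simp add: zero_le_mult_iff)
  qed
  have "Cauchy (\<lambda>m. D m w)" for w
  proof (rule CauchyI)
    fix \<epsilon> :: real assume \<epsilon>: "\<epsilon> > 0"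
    define q where "q = 4 * K * (norm w)\<^sup>2 + 1"
    \<comment> \<open>Dividing the quadratic errors by \<open>t\<close> leaves multiples of
      \<open>t\<close>. This \<open>t\<close> keeps \<open>a + t w\<close> in range and makes
      \<open>4 K t (norm w)^2\<close> at most \<open>\<epsilon> - t\<close>; the slack
      \<open>t\<close> yields a strict inequality.\<close>
    define t where "t = min (\<rho> / (norm w + 1)) (\<epsilon> / q)"
    have q: "q > 0" using K by (simp add: q_def add_nonneg_pos)
    have "t \<le> \<rho> / (norm w + 1)" by (simp add: t_def)
    then have "t * (norm w + 1) \<le> \<rho>"
      by (metis norm_ge_zero add_nonneg_pos less_numeral_extra(1) pos_le_divide_eq)
    moreover have "t > 0" using \<rho> \<epsilon> q by (simp add: t_def add_nonneg_pos)
    ultimately have t: "t > 0" "t * norm w \<le> \<rho>" by (auto simp: algebra_simps)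
    have "t * q \<le> \<epsilon>" using q by (simp add: t_def min_def field_simps)
    then have t2: "4 * K * t * (norm w)\<^sup>2 \<le> \<epsilon> - t" by (simp add: q_def algebra_simps)
    have tw: "norm (t *\<^sub>R w) \<le> \<rho>" using t by simp
    have "Cauchy (\<lambda>m. gs m (a + t *\<^sub>R w) - gs m a)"
      using tendsto_diff[OF lim[OF tw] lim[of 0]] \<rho> by (simp add: LIMSEQ_imp_Cauchy)
    then obtain N where N: "\<And>m n. m \<ge> N \<Longrightarrow> n \<ge> N \<Longrightarrow>
        norm ((gs m (a + t *\<^sub>R w) - gs m a) - (gs n (a + t *\<^sub>R w) - gs n a)) < t * \<epsilon> / 2"
      using \<epsilon> t by (meson CauchyD half_gt_zero mult_pos_pos)
    have tri: "norm (x - y) \<le> norm (p - q) + norm (p - x) + norm (q - y)" for x y p q :: 'b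
      by norm
    have "norm (D m w - D n w) < \<epsilon>" if "m \<ge> N" "n \<ge> N" for m n
    proof -
      have "norm (D m (t *\<^sub>R w) - D n (t *\<^sub>R w)) < t * \<epsilon> / 2 + 2 * (K * (norm (t *\<^sub>R w))\<^sup>2)"
        using N[OF that] bd[OF tw, of m] bd[OF tw, of n] tri by (smt (verit))
      also have "D m (t *\<^sub>R w) - D n (t *\<^sub>R w) = t *\<^sub>R (D m w - D n w)"
        by (simp add: linear_scale[OF lin] scaleR_diff_right)
      also have "t * \<epsilon> / 2 + 2 * (K * (norm (t *\<^sub>R w))\<^sup>2) = t * (\<epsilon> / 2 + (4 * K * t * (norm w)\<^sup>2) / 2)"
        using t by (simp add: power_mult_distrib algebra_simps power2_eq_square)
      also have "\<dots> \<le> t * (\<epsilon> / 2 + (\<epsilon> - t) / 2)" using t t2 by (intro mult_left_mono) auto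
      also have "\<dots> < t * \<epsilon>" using mult_pos_pos[OF t(1) t(1)] by (simp add: field_simps)
      finally show ?thesis using t by simp
    qed
    then show "\<exists>M. \<forall>m\<ge>M. \<forall>n\<ge>M. norm (D m w - D n w) < \<epsilon>" by blast
  qed
  then have conv: "(\<lambda>m. D m w) \<longlonglongrightarrow> lim (\<lambda>m. D m w)" for w
    by (simp add: Cauchy_convergent_iff convergent_LIMSEQ_iff)
  define L where "L = (\<lambda>w. lim (\<lambda>m. D m w))"
  have "linear L"
  proof (rule linearI)
    show "L (x + y) = L x + L y" for x y
      using LIMSEQ_unique[OF conv[of "x + y"]] tendsto_add[OF conv[of x] conv[of y]]
      by (simp add: L_def linear_add[OF lin])
    show "L (r *\<^sub>R x) = r *\<^sub>R L x" for r x
      using LIMSEQ_unique[OF conv[of "r *\<^sub>R x"]] tendsto_scaleR[OF tendsto_const conv[of x]]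
      by (simp add: L_def linear_scale[OF lin])
  qed
  then have bl: "bounded_linear L" by (simp add: linear_linear)
  \<comment> \<open>The bound is uniform in \<open>m\<close>, so it survives the limit and exhibits
    \<open>L\<close> as the derivative.\<close>
  have q: "norm (g (a + w) - g a - L w) \<le> K * (norm w)\<^sup>2" if w: "norm w \<le> \<rho>" for w
  proof (rule Lim_bounded)
    show "(\<lambda>m. norm (gs m (a + w) - gs m a - D m w)) \<longlonglongrightarrow> norm (g (a + w) - g a - L w)"
      using lim[OF w] lim[of 0] conv[of w] \<rho> unfolding L_def by (intro tendsto_intros) auto
  qed (use bd[OF w] in auto)
  have "(g has_derivative L) (at a)"
    unfolding has_derivative_within_alt
  proof (intro conjI allI impI bl)
    fix \<epsilon> :: real assume \<epsilon>: "\<epsilon> > 0"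
    define d where "d = min \<rho> (\<epsilon> / (K + 1))"
    have d: "d > 0" using \<rho> \<epsilon> K by (simp add: d_def)
    have "norm (g y - g a - L (y - a)) \<le> \<epsilon> * norm (y - a)" if y: "norm (y - a) < d" for y
    proof -
      have "norm (g y - g a - L (y - a)) \<le> K * (norm (y - a))\<^sup>2"
        using q[of "y - a"] y by (simp add: d_def)
      also have "\<dots> = (K * norm (y - a)) * norm (y - a)" by (simp add: power2_eq_square)
      also have "K * norm (y - a) \<le> \<epsilon>"
      proof -
        have "K * norm (y - a) \<le> (K + 1) * norm (y - a)" by (intro mult_right_mono) auto
        also have "\<dots> \<le> (K + 1) * (\<epsilon> / (K + 1))"
          using y K by (intro mult_left_mono) (auto simp: d_def)
        finally show ?thesis using K by simp
      qed
      finally show ?thesis by (simp add: mult_right_mono)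
    qed
    then show "\<exists>d>0. \<forall>y\<in>UNIV. norm (y - a) < d \<longrightarrow> norm (g y - g a - L (y - a)) \<le> \<epsilon> * norm (y - a)"
      using d by blast
  qed
  then show ?thesis by (auto simp: differentiable_def)
qed

section \<open>Complex differentiability in two vector variables\<close>

lemma complex_differentiable2_left:
  assumes "complex_differentiable2_at F (x, y)"
  shows "complex_differentiable_at (\<lambda>x. F (x, y)) x"
proof -
  obtain D E where DE: "clinear D" "clinear E" "(F has_derivative (\<lambda>(u, v). D u + E v)) (at (x, y))"
    using assms unfolding complex_differentiable2_at_def by blast
  have "((\<lambda>x. F (x, y)) has_derivative (\<lambda>u. case (u, 0) of (u, v) \<Rightarrow> D u + E v)) (at x)"
    by (rule has_derivative_compose[of "\<lambda>x. (x, y)"]) (auto intro!: derivative_eq_intros DE(3))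
  then show ?thesis
    using DE vec.linear_0[OF DE(2)] unfolding complex_differentiable_at_def by auto
qed

lemma complex_differentiable2_right:
  assumes "complex_differentiable2_at F (x, y)"
  shows "complex_differentiable_at (\<lambda>y. F (x, y)) y"
proof -
  obtain D E where DE: "clinear D" "clinear E" "(F has_derivative (\<lambda>(u, v). D u + E v)) (at (x, y))"
    using assms unfolding complex_differentiable2_at_def by blast
  have "((\<lambda>y. F (x, y)) has_derivative (\<lambda>v. case (0, v) of (u, v) \<Rightarrow> D u + E v)) (at y)"
    by (rule has_derivative_compose[of "\<lambda>y. (x, y)"]) (auto intro!: derivative_eq_intros DE(3))
  then show ?thesis
    using DE vec.linear_0[OF DE(1)] unfolding complex_differentiable_at_def by auto
qed

lemma complex_differentiable_at_frechet:
  fixes f :: "complex^'n::finite \<Rightarrow> complex^'m::finite"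
  assumes "complex_differentiable_at f x"
  shows "(f has_derivative frechet_derivative f (at x)) (at x)"
    and "clinear (frechet_derivative f (at x))"
  using assms frechet_derivative_at unfolding complex_differentiable_at_def by metis+

text \<open>The partial derivative in \<open>y\<close> is the limit of the difference quotients
  \<open>gs m\<close>. These are complex differentiable in \<open>x\<close> and uniformly bounded,
  so Cauchy estimates give them quadratic expansions with one common constant, and
  \<open>has_derivative_pointwise_limit\<close> applies.\<close>

lemma differentiable_partial_derivative:
  fixes F :: "(complex^'n::finite) \<times> (complex^'k::finite) \<Rightarrow> complex^'m::finite"
  assumes cd: "\<And>x y. x \<in> ball a R \<Longrightarrow> y \<in> ball b R \<Longrightarrow> complex_differentiable2_at F (x, y)"
    and bd: "\<And>x y. x \<in> ball a R \<Longrightarrow> y \<in> ball b R \<Longrightarrow> norm (F (x, y)) \<le> M" and R: "R > 0"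
  shows "(\<lambda>x. frechet_derivative (\<lambda>y. F (x, y)) (at b) Y) differentiable (at a)"
proof -
  define g where "g = (\<lambda>x. frechet_derivative (\<lambda>y. F (x, y)) (at b) Y)"
  define K where "K = of_nat CARD('m) * (18 * M / R\<^sup>2)"
  have M: "M \<ge> 0" using bd[of a b] R by (meson centre_in_ball norm_ge_zero order_trans)
  have K: "K \<ge> 0" using M by (simp add: K_def)
  have q: "norm (F (x, b + t *\<^sub>R Y) - F (x, b) - t *\<^sub>R g x) \<le> K * (norm (t *\<^sub>R Y))\<^sup>2"
    if x: "x \<in> ball a R" and t: "norm (t *\<^sub>R Y) \<le> R / 3" for x t
  proof -
    have c: "complex_differentiable_at (\<lambda>y. F (x, y)) y" if "y \<in> ball b R" for y
      using complex_differentiable2_right cd[OF x that] by blast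
    have der: "((\<lambda>y. F (x, y)) has_derivative frechet_derivative (\<lambda>y. F (x, y)) (at b)) (at b)"
      using R by (intro complex_differentiable_at_frechet c) auto
    show ?thesis
      using complex_differentiable_quadratic_bound[OF c bd[OF x] der t R]
      by (simp add: K_def g_def linear_scale[OF has_derivative_linear[OF der]])
  qed
  \<comment> \<open>The largest step: it keeps \<open>t0 Y\<close> within \<open>R / 3\<close>, and
    the added 1 covers \<open>Y = 0\<close>.\<close>
  define t0 where "t0 = R / 3 / (norm Y + 1)"
  have t0: "t0 > 0" using R by (simp add: t0_def add_nonneg_pos)
  have small: "norm (t *\<^sub>R Y) \<le> R / 3" if "0 < t" "t \<le> t0" for t
  proof -
    have "t * norm Y \<le> t0 * (norm Y + 1)" using that by (intro mult_mono) auto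
    also have "\<dots> = R / 3" unfolding t0_def
      by (rule nonzero_eq_divide_eq[THEN iffD1, OF _ refl])
        (use add_nonneg_pos[OF norm_ge_zero[of Y] zero_less_one] in simp)
    finally show ?thesis using that by simp
  qed
  define gs where "gs = (\<lambda>m::nat. \<lambda>x. inverse (t0 / Suc m) *\<^sub>R (F (x, b + (t0 / Suc m) *\<^sub>R Y) - F (x, b)))"
  have tm: "0 < t0 / Suc m" "t0 / Suc m \<le> t0" for m
    using t0 by (auto simp: field_simps)
  have close: "norm (gs m x - g x) \<le> K * (norm Y)\<^sup>2 * (t0 / Suc m)" if x: "x \<in> ball a R" for m x
  proof -
    define t where "t = t0 / Suc m"
    have t: "0 < t" "t \<le> t0" using tm[of m] by (auto simp: t_def)
    have "gs m x - g x = inverse t *\<^sub>R (F (x, b + t *\<^sub>R Y) - F (x, b) - t *\<^sub>R g x)"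
      using t unfolding gs_def t_def[symmetric] by (simp add: scaleR_diff_right)
    then have "norm (gs m x - g x) = inverse t * norm (F (x, b + t *\<^sub>R Y) - F (x, b) - t *\<^sub>R g x)"
      using t by simp
    also have "\<dots> \<le> inverse t * (K * (norm (t *\<^sub>R Y))\<^sup>2)"
      using q[OF x small[OF t]] t by (intro mult_left_mono) auto
    also have "\<dots> = K * (norm Y)\<^sup>2 * t" using t by (simp add: power_mult_distrib power2_eq_square)
    finally show ?thesis by (simp add: t_def)
  qed
  \<comment> \<open>The three summands bound \<open>gs m - g\<close>, \<open>gs 0\<close> and
    \<open>g - gs 0\<close>; only \<open>gs 0\<close> is estimated directly, since its step does not
    shrink.\<close>
  define B where "B = K * (norm Y)\<^sup>2 * t0 + (2 * M / t0 + K * (norm Y)\<^sup>2 * t0)"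
  have gsbd: "norm (gs m x) \<le> B" if x: "x \<in> ball a R" for m x
  proof -
    have inb: "b + t0 *\<^sub>R Y \<in> ball b R" using small[of t0] t0 R by (simp add: dist_norm)
    have "norm (F (x, b + t0 *\<^sub>R Y) - F (x, b)) \<le> 2 * M"
      using bd[OF x inb] bd[OF x, of b] R norm_triangle_ineq4[of "F (x, b + t0 *\<^sub>R Y)" "F (x, b)"]
      by simp
    then have "inverse t0 * norm (F (x, b + t0 *\<^sub>R Y) - F (x, b)) \<le> inverse t0 * (2 * M)"
      using t0 by (intro mult_left_mono) auto
    moreover have "norm (gs 0 x) = inverse t0 * norm (F (x, b + t0 *\<^sub>R Y) - F (x, b))"
      using t0 unfolding gs_def norm_scaleR by simp
    ultimately have "norm (gs 0 x) \<le> inverse t0 * (2 * M)" by simp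
    moreover have "K * (norm Y)\<^sup>2 * (t0 / Suc n) \<le> K * (norm Y)\<^sup>2 * t0" for n
      using tm K by (intro mult_left_mono) auto
    ultimately show ?thesis using close[OF x, of m] close[OF x, of 0]
      unfolding B_def by (smt (verit) norm_triangle_sub norm_minus_commute divide_inverse mult.commute)
  qed
  have gscd: "complex_differentiable_at (gs m) x" if x: "x \<in> ball a R" for m x
  proof -
    define t where "t = t0 / Suc m"
    have "norm (t *\<^sub>R Y) \<le> R / 3" using small[of t] tm[of m] unfolding t_def by blast
    then have "b + t *\<^sub>R Y \<in> ball b R" using R by (simp add: dist_norm)
    then obtain D E where D: "clinear D" "((\<lambda>x. F (x, b + t *\<^sub>R Y)) has_derivative D) (at x)"
      and E: "clinear E" "((\<lambda>x. F (x, b)) has_derivative E) (at x)"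
      using complex_differentiable2_left cd x R unfolding complex_differentiable_at_def
      by (metis centre_in_ball)
    have "(gs m has_derivative (\<lambda>u. inverse t *\<^sub>R (D u - E u))) (at x)"
      unfolding gs_def t_def[symmetric] by (intro derivative_intros D E)
    moreover have "clinear (\<lambda>u. inverse t *\<^sub>R (D u - E u))"
      using D(1) E(1) by (auto simp: Vector_Spaces.linear_iff vec_eq_iff algebra_simps)
    ultimately show ?thesis unfolding complex_differentiable_at_def by blast
  qed
  have der: "(gs m has_derivative frechet_derivative (gs m) (at a)) (at a)" for m
    using R by (intro complex_differentiable_at_frechet gscd) auto
  have "g differentiable (at a)"
  proof (rule has_derivative_pointwise_limit)
    show "linear (frechet_derivative (gs m) (at a))" for m
      by (rule has_derivative_linear[OF der])
    show "norm (gs m (a + w) - gs m a - frechet_derivative (gs m) (at a) w)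
        \<le> of_nat CARD('m) * (18 * B / R\<^sup>2) * (norm w)\<^sup>2" if "norm w \<le> R / 3" for m w
      by (rule complex_differentiable_quadratic_bound[OF gscd gsbd der that R])
    show "(\<lambda>m. gs m (a + w)) \<longlonglongrightarrow> g (a + w)" if "norm w \<le> R / 3" for w
    proof (rule LIM_zero_cancel, rule Lim_null_comparison)
      show "\<forall>\<^sub>F m in sequentially. norm (gs m (a + w) - g (a + w)) \<le> K * (norm Y)\<^sup>2 * (t0 / Suc m)"
        using that R by (intro always_eventually allI close) (simp add: dist_norm)
      have "(\<lambda>m. K * (norm Y)\<^sup>2 * t0 * inverse (real (Suc m))) \<longlonglongrightarrow> K * (norm Y)\<^sup>2 * t0 * 0"
        by (intro tendsto_intros LIMSEQ_inverse_real_of_nat)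
      then show "(\<lambda>m. K * (norm Y)\<^sup>2 * (t0 / Suc m)) \<longlonglongrightarrow> 0"
        by (simp add: divide_inverse mult.assoc)
    qed
  qed (use R in auto)
  then show ?thesis by (simp add: g_def)
qed

lemma complex_differentiable2_compose:
  assumes "complex_differentiable2_at F (u q, v q)"
    and "complex_differentiable2_at u q" and "complex_differentiable2_at v q"
  shows "complex_differentiable2_at (\<lambda>q. F (u q, v q)) q"
proof -
  obtain D E where F: "clinear D" "clinear E" "(F has_derivative (\<lambda>(x, y). D x + E y)) (at (u q, v q))"
    using assms(1) unfolding complex_differentiable2_at_def by blast
  obtain D1 E1 where u: "clinear D1" "clinear E1" "(u has_derivative (\<lambda>(x, y). D1 x + E1 y)) (at q)"
    using assms(2) unfolding complex_differentiable2_at_def by blast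
  obtain D2 E2 where v: "clinear D2" "clinear E2" "(v has_derivative (\<lambda>(x, y). D2 x + E2 y)) (at q)"
    using assms(3) unfolding complex_differentiable2_at_def by blast
  have "((\<lambda>q. (u q, v q)) has_derivative
      (\<lambda>p. ((\<lambda>(x, y). D1 x + E1 y) p, (\<lambda>(x, y). D2 x + E2 y) p))) (at q)"
    by (intro has_derivative_Pair u v)
  from has_derivative_compose[OF this F(3)]
  have "((\<lambda>q. F (u q, v q)) has_derivative
      (\<lambda>(x, y). (D (D1 x) + E (D2 x)) + (D (E1 y) + E (E2 y)))) (at q)"
    using F(1,2) by (auto simp: Vector_Spaces.linear_iff case_prod_unfold algebra_simps)
  moreover have "clinear (\<lambda>x. D (D1 x) + E (D2 x))" "clinear (\<lambda>x. D (E1 x) + E (E2 x))"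
    using F u v by (auto simp: Vector_Spaces.linear_iff algebra_simps)
  ultimately show ?thesis unfolding complex_differentiable2_at_def by blast
qed

lemma complex_differentiable2_fst:
  assumes "complex_differentiable_at f (fst q)"
  shows "complex_differentiable2_at (\<lambda>q. f (fst q)) q"
proof -
  obtain D where D: "clinear D" "(f has_derivative D) (at (fst q))"
    using assms unfolding complex_differentiable_at_def by blast
  have "(fst has_derivative fst) (at q)" by (rule has_derivative_fst[OF has_derivative_ident])
  from has_derivative_compose[OF this D(2)]
  have "((\<lambda>q. f (fst q)) has_derivative (\<lambda>p. D (fst p))) (at q)" .
  then show ?thesis
    unfolding complex_differentiable2_at_def using D(1)
    by (intro exI[of _ D] exI[of _ "\<lambda>_. 0"] conjI)
      (auto simp: Vector_Spaces.linear_iff vec.vector_space_axioms case_prod_unfold)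
qed

lemma complex_differentiable2_transform:
  assumes "complex_differentiable2_at F q" "\<forall>\<^sub>F p in nhds q. F p = H p"
  shows "complex_differentiable2_at H q"
proof -
  have "\<forall>\<^sub>F p in at q. F p = H p" "F q = H q"
    using assms(2) by (auto simp: eventually_nhds_conv_at)
  then show ?thesis
    using assms(1) has_derivative_transform_eventually
    unfolding complex_differentiable2_at_def by blast
qed

section \<open>Uniqueness for linear differential equations\<close>

lemma linear_ode_unique:
  fixes u v :: "real \<Rightarrow> 'a::real_inner"
  assumes B: "bounded_linear B" and init: "u 0 = v 0" and T: "0 \<le> T"
    and u: "\<And>t. (u has_vector_derivative B (u t)) (at t)"
    and v: "\<And>t. (v has_vector_derivative B (v t)) (at t)"
  shows "u T = v T"
proof -
  obtain K where K: "\<And>x. norm (B x) \<le> norm x * K" "K > 0"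
    using bounded_linear.pos_bounded[OF B] by blast
  define w where "w = (\<lambda>t. u t - v t)"
  have w: "(w has_vector_derivative B (w t)) (at t)" for t
    unfolding w_def bounded_linear.linear[OF B, THEN linear_diff]
    by (intro derivative_intros u v)
  \<comment> \<open>Gronwall's argument: the derivative of \<open>w t \<bullet> w t\<close> is at
    most \<open>2 K\<close> times its value, so this weight makes the product nonincreasing.\<close>
  define y where "y = (\<lambda>t. exp (- 2 * K * t) * (w t \<bullet> w t))"
  have y: "(y has_real_derivative
      exp (- 2 * K * t) * (2 * (w t \<bullet> B (w t))) - 2 * K * exp (- 2 * K * t) * (w t \<bullet> w t)) (at t)" for t
  proof -
    have "((\<lambda>t. w t \<bullet> w t) has_vector_derivative w t \<bullet> B (w t) + B (w t) \<bullet> w t) (at t)"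
      by (rule bounded_bilinear.has_vector_derivative[OF bounded_bilinear_inner w w])
    then have "((\<lambda>t. w t \<bullet> w t) has_real_derivative 2 * (w t \<bullet> B (w t))) (at t)"
      by (simp add: has_real_derivative_iff_has_vector_derivative inner_commute)
    then show ?thesis unfolding y_def by (auto intro!: derivative_eq_intros)
  qed
  have "y T \<le> y 0"
  proof (rule DERIV_nonpos_imp_nonincreasing[OF T])
    fix t
    have "w t \<bullet> B (w t) \<le> norm (w t) * (norm (w t) * K)"
      using norm_cauchy_schwarz[of "w t" "B (w t)"] mult_left_mono[OF K(1)[of "w t"] norm_ge_zero[of "w t"]]
      by linarith
    then have "2 * (w t \<bullet> B (w t)) - 2 * K * (w t \<bullet> w t) \<le> 0"
      by (simp add: dot_square_norm power2_eq_square algebra_simps)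
    then have "exp (- 2 * K * t) * (2 * (w t \<bullet> B (w t)) - 2 * K * (w t \<bullet> w t)) \<le> 0"
      by (simp add: mult_nonneg_nonpos)
    then show "\<exists>y'. (y has_real_derivative y') (at t) \<and> y' \<le> 0"
      using y[of t] by (auto simp: algebra_simps)
  qed
  then have "w T \<bullet> w T \<le> 0" using init by (simp add: y_def w_def mult_le_0_iff)
  then have "w T = 0" by (metis inner_eq_zero_iff inner_ge_zero order_antisym)
  then show ?thesis by (simp add: w_def)
qed

section \<open>The adjoint representation of a complex Lie group\<close>

locale lie_chart =
  fixes G :: "('g::t2_space) monoid" (structure)
    and A :: "('g, 'n::finite) chart set" and k :: "('g, 'n) chart"
    and Exp :: "complex^'n \<Rightarrow> 'g"
  assumes lie: "complex_lie_group G A" and k: "k \<in> A" and one_k: "\<one> \<in> fst k"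
    and Exp: "is_lie_exp G k Exp"
begin

abbreviation "Ad \<equiv> lie_Ad G k"
abbreviation "br \<equiv> lie_bracket G k"
abbreviation "origin \<equiv> snd k \<one>"

section \<open>Charts and limits in the group\<close>

lemma is_group: "group G"
  using lie by (simp add: complex_lie_group_def)

sublocale group G by (rule is_group)

lemma manifold: "complex_manifold (carrier G) A"
  using lie by (simp add: complex_lie_group_def)

lemma chart_cover: "g \<in> carrier G \<Longrightarrow> \<exists>l\<in>A. g \<in> fst l"
  using manifold unfolding complex_manifold_def by blast

lemma chart:
  assumes "l \<in> A"
  shows "openin (top_of_set (carrier G)) (fst l)" "open (snd l ` fst l)"
    "homeomorphism (fst l) (snd l ` fst l) (snd l) (chart_inv l)"
  using manifold assms unfolding complex_manifold_def by auto

lemma chart_carrier: "l \<in> A \<Longrightarrow> g \<in> fst l \<Longrightarrow> g \<in> carrier G"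
  using chart(1) openin_imp_subset by blast

lemma chart_inv_chart: "l \<in> A \<Longrightarrow> g \<in> fst l \<Longrightarrow> chart_inv l (snd l g) = g"
  using chart(3) homeomorphism_apply1 by metis

lemma chart_inv_in: "l \<in> A \<Longrightarrow> x \<in> snd l ` fst l \<Longrightarrow> chart_inv l x \<in> fst l"
  using chart_inv_chart by fastforce

text \<open>Limits are taken along \<open>nhds\<close> rather than \<open>at\<close>, so that
  eventual properties also hold at the point itself.\<close>

lemma tendsto_chart_inv:
  assumes "l \<in> A" "g \<in> fst l"
  shows "(chart_inv l \<longlongrightarrow> g) (nhds (snd l g))"
proof -
  have "continuous_on (snd l ` fst l) (chart_inv l)"
    using chart(3)[OF assms(1)] homeomorphism_cont2 by metis
  then have "isCont (chart_inv l) (snd l g)"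
    using chart(2)[OF assms(1)] assms(2) by (simp add: continuous_on_eq_continuous_at)
  then show ?thesis
    using chart_inv_chart[OF assms] unfolding isCont_def tendsto_at_iff_tendsto_nhds by simp
qed

text \<open>Chart domains are open only relative to \<open>carrier G\<close>, hence the separate
  condition that \<open>u\<close> stays in the carrier.\<close>

lemma eventually_in_chart:
  assumes "(u \<longlongrightarrow> g) F" "\<forall>\<^sub>F x in F. u x \<in> carrier G" "l \<in> A" "g \<in> fst l"
  shows "\<forall>\<^sub>F x in F. u x \<in> fst l"
proof -
  obtain T where T: "open T" "fst l = carrier G \<inter> T"
    using chart(1)[OF assms(3)] by (auto simp: openin_open)
  have "\<forall>\<^sub>F x in F. u x \<in> T" using topological_tendstoD[OF assms(1) T(1)] T assms(4) by auto
  then show ?thesis using assms(2) by eventually_elim (simp add: T)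
qed

lemma tendsto_mult:
  assumes "(u \<longlongrightarrow> g) F" "(v \<longlongrightarrow> h) F" "g \<in> carrier G" "h \<in> carrier G"
    "\<forall>\<^sub>F x in F. u x \<in> carrier G" "\<forall>\<^sub>F x in F. v x \<in> carrier G"
  shows "((\<lambda>x. u x \<otimes> v x) \<longlongrightarrow> g \<otimes> h) F"
proof -
  have "continuous_on (carrier G \<times> carrier G) (\<lambda>(x, y). x \<otimes> y)"
    using lie by (simp add: complex_lie_group_def)
  moreover have "((\<lambda>x. (u x, v x)) \<longlongrightarrow> (g, h)) F" by (intro tendsto_Pair assms)
  moreover have "\<forall>\<^sub>F x in F. (u x, v x) \<in> carrier G \<times> carrier G"
    using assms(5,6) by eventually_elim simp
  ultimately show ?thesis
    using continuous_on_tendsto_compose[of "carrier G \<times> carrier G" "\<lambda>(x, y). x \<otimes> y"] assms(3,4)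
    by fastforce
qed

lemma tendsto_inv:
  assumes "(u \<longlongrightarrow> g) F" "g \<in> carrier G" "\<forall>\<^sub>F x in F. u x \<in> carrier G"
  shows "((\<lambda>x. inv u x) \<longlongrightarrow> inv g) F"
proof -
  have "continuous_on (carrier G) (\<lambda>x. inv x)"
    using lie by (simp add: complex_lie_group_def)
  then show ?thesis using continuous_on_tendsto_compose assms by blast
qed

section \<open>Conjugation in coordinates and the differentiability of \<open>Ad\<close>\<close>

definition conj_chart :: "('g, 'n) chart \<Rightarrow> (complex^'n) \<times> (complex^'n) \<Rightarrow> complex^'n" where
  "conj_chart l q =
     snd k (chart_inv l (fst q) \<otimes> chart_inv k (snd q) \<otimes> inv (chart_inv l (fst q)))"

text \<open>Multiplication and inversion are known to be differentiable only where their results lie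
  in the chosen charts. Conjugation is therefore factored through \<open>l\<close> for the first
  product and through a chart \<open>p\<close> around the inverse of \<open>g\<close>; continuity
  keeps all intermediate values in these charts near \<open>(g, \<one>)\<close>.\<close>

lemma conj_chart_differentiable:
  assumes l: "l \<in> A" and g: "g \<in> fst l"
  shows "\<forall>\<^sub>F q in nhds (snd l g, origin). complex_differentiable2_at (conj_chart l) q"
proof -
  let ?N = "nhds (snd l g, origin)"
  have gG: "g \<in> carrier G" using chart_carrier[OF l g] .
  obtain p where p: "p \<in> A" "inv g \<in> fst p" using chart_cover gG by blast
  have fst_lim: "(fst \<longlongrightarrow> snd l g) ?N" and snd_lim: "(snd \<longlongrightarrow> origin) ?N"
    by (auto simp: nhds_prod filterlim_fst filterlim_snd)
  have lim1: "((\<lambda>q. chart_inv l (fst q)) \<longlongrightarrow> g) ?N"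
    using filterlim_compose[OF tendsto_chart_inv[OF l g] fst_lim] .
  have lim2: "((\<lambda>q. chart_inv k (snd q)) \<longlongrightarrow> \<one>) ?N"
    using filterlim_compose[OF tendsto_chart_inv[OF k one_k] snd_lim] .
  have e1: "\<forall>\<^sub>F q in ?N. fst q \<in> snd l ` fst l"
    using topological_tendstoD[OF fst_lim chart(2)[OF l]] g by auto
  have e2: "\<forall>\<^sub>F q in ?N. snd q \<in> snd k ` fst k"
    using topological_tendstoD[OF snd_lim chart(2)[OF k]] one_k by auto
  have c1: "\<forall>\<^sub>F q in ?N. chart_inv l (fst q) \<in> carrier G"
    using e1 by eventually_elim (metis chart_carrier chart_inv_in l)
  have c2: "\<forall>\<^sub>F q in ?N. chart_inv k (snd q) \<in> carrier G"
    using e2 by eventually_elim (metis chart_carrier chart_inv_in k)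
  have lim3: "((\<lambda>q. chart_inv l (fst q) \<otimes> chart_inv k (snd q)) \<longlongrightarrow> g) ?N"
    using tendsto_mult[OF lim1 lim2 gG one_closed c1 c2] gG by simp
  have c3: "\<forall>\<^sub>F q in ?N. chart_inv l (fst q) \<otimes> chart_inv k (snd q) \<in> carrier G"
    using c1 c2 by eventually_elim simp
  have lim4: "((\<lambda>q. inv (chart_inv l (fst q))) \<longlongrightarrow> inv g) ?N"
    by (rule tendsto_inv[OF lim1 gG c1])
  have c4: "\<forall>\<^sub>F q in ?N. inv (chart_inv l (fst q)) \<in> carrier G"
    using c1 by eventually_elim simp
  have lim5: "((\<lambda>q. chart_inv l (fst q) \<otimes> chart_inv k (snd q) \<otimes> inv (chart_inv l (fst q))) \<longlongrightarrow> \<one>) ?N"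
    using tendsto_mult[OF lim3 lim4 gG _ c3 c4] gG by simp
  have c5: "\<forall>\<^sub>F q in ?N. chart_inv l (fst q) \<otimes> chart_inv k (snd q) \<otimes> inv (chart_inv l (fst q)) \<in> carrier G"
    using c3 c4 by eventually_elim simp
  define P where "P = (\<lambda>q. fst q \<in> snd l ` fst l \<and> snd q \<in> snd k ` fst k \<and>
    chart_inv l (fst q) \<otimes> chart_inv k (snd q) \<in> fst l \<and> inv (chart_inv l (fst q)) \<in> fst p \<and>
    chart_inv l (fst q) \<otimes> chart_inv k (snd q) \<otimes> inv (chart_inv l (fst q)) \<in> fst k)"
  have "\<forall>\<^sub>F q in ?N. P q"
    using e1 e2 eventually_in_chart[OF lim3 c3 l g] eventually_in_chart[OF lim4 c4 p]
      eventually_in_chart[OF lim5 c5 k one_k]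
    unfolding P_def by eventually_elim simp
  \<comment> \<open>A derivative at \<open>q\<close> needs the factorisation on a whole
    neighbourhood of \<open>q\<close>.\<close>
  then have "\<forall>\<^sub>F q in ?N. \<forall>\<^sub>F q' in nhds q. P q'" by (simp add: eventually_eventually)
  then show ?thesis
  proof eventually_elim
    case (elim q)
    then have q: "P q" by (rule eventually_nhds_x_imp_x)
    define u where "u = (\<lambda>(x, y). snd l (chart_inv l x \<otimes> chart_inv k y))"
    define i where "i = (\<lambda>x. snd p (inv (chart_inv l x)))"
    define m where "m = (\<lambda>(x, y). snd k (chart_inv l x \<otimes> chart_inv p y))"
    have u: "complex_differentiable2_at u (fst q, snd q)"
      using lie l k q unfolding complex_lie_group_def P_def u_def by blast
    have i: "complex_differentiable_at i (fst q)"
      using lie l p q unfolding complex_lie_group_def P_def i_def by blast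
    have eq: "chart_inv l (u q') = chart_inv l (fst q') \<otimes> chart_inv k (snd q')"
      "chart_inv p (i (fst q')) = inv (chart_inv l (fst q'))" if "P q'" for q'
      using that l p unfolding P_def u_def i_def by (auto simp: chart_inv_chart case_prod_unfold)
    have "u q \<in> snd l ` fst l" "i (fst q) \<in> snd p ` fst p"
      using q unfolding P_def u_def i_def by (auto simp: case_prod_unfold)
    moreover have "chart_inv l (u q) \<otimes> chart_inv p (i (fst q)) \<in> fst k"
      using q eq[OF q] unfolding P_def by simp
    ultimately have "complex_differentiable2_at m (u q, i (fst q))"
      using lie l p k unfolding complex_lie_group_def m_def by blast
    then have "complex_differentiable2_at (\<lambda>q. m (u q, i (fst q))) q"
      using u i by (intro complex_differentiable2_compose complex_differentiable2_fst) auto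
    moreover have "\<forall>\<^sub>F q' in nhds q. m (u q', i (fst q')) = conj_chart l q'"
      using elim by eventually_elim (simp add: m_def conj_chart_def eq)
    ultimately show ?case by (rule complex_differentiable2_transform)
  qed
qed

text \<open>The slice of \<open>conj_chart\<close> in its second variable is complex differentiable,
  so the \<open>frechet_derivative\<close> defining \<open>lie_Ad\<close> is a genuine
  derivative.\<close>

lemma Ad_derivative:
  assumes "g \<in> carrier G"
  shows "((\<lambda>x. snd k (g \<otimes> chart_inv k x \<otimes> inv g)) has_derivative Ad g) (at origin)"
    and "clinear (Ad g)"
proof -
  obtain l where l: "l \<in> A" "g \<in> fst l" using chart_cover assms by blast
  have "complex_differentiable2_at (conj_chart l) (snd l g, origin)"
    using conj_chart_differentiable[OF l] by (rule eventually_nhds_x_imp_x)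
  from complex_differentiable2_right[OF this]
  have "complex_differentiable_at (\<lambda>x. snd k (g \<otimes> chart_inv k x \<otimes> inv g)) origin"
    by (simp add: conj_chart_def chart_inv_chart l)
  from complex_differentiable_at_frechet[OF this]
  show "((\<lambda>x. snd k (g \<otimes> chart_inv k x \<otimes> inv g)) has_derivative Ad g) (at origin)"
    and "clinear (Ad g)"
    by (auto simp: lie_Ad_def)
qed

lemma bounded_linear_Ad: "g \<in> carrier G \<Longrightarrow> bounded_linear (Ad g)"
  using has_derivative_bounded_linear[OF Ad_derivative(1)] .

lemma Ad_simps:
  assumes "g \<in> carrier G"
  shows "Ad g (X + Y) = Ad g X + Ad g Y" "Ad g (z *s X) = z *s Ad g X"
  using Ad_derivative(2)[OF assms] by (auto simp: Vector_Spaces.linear_iff)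

text \<open>In coordinates, \<open>Ad\<close> near the identity is the partial derivative of
  \<open>conj_chart k\<close> in its second variable. Continuity gives the local bound required to
  differentiate it once more.\<close>

lemma bracket_derivative:
  "((\<lambda>x. Ad (chart_inv k x) Y) has_derivative (\<lambda>X. br X Y)) (at origin)"
proof -
  have "isCont (conj_chart k) (origin, origin)"
    using eventually_nhds_x_imp_x[OF conj_chart_differentiable[OF k one_k]] has_derivative_continuous
    unfolding complex_differentiable2_at_def by blast
  then have "(conj_chart k \<longlongrightarrow> conj_chart k (origin, origin)) (nhds (origin, origin))"
    unfolding isCont_def tendsto_at_iff_tendsto_nhds .
  then have "\<forall>\<^sub>F q in nhds (origin, origin). norm (conj_chart k q) < norm (conj_chart k (origin, origin)) + 1"
    by (intro order_tendstoD(2)[OF tendsto_norm]) auto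
  then have "\<forall>\<^sub>F q in nhds (origin, origin). complex_differentiable2_at (conj_chart k) q \<and>
      norm (conj_chart k q) < norm (conj_chart k (origin, origin)) + 1"
    using conj_chart_differentiable[OF k one_k] by eventually_elim simp
  then obtain d where d: "d > 0" "\<And>q. dist q (origin, origin) < d \<Longrightarrow>
      complex_differentiable2_at (conj_chart k) q \<and> norm (conj_chart k q) < norm (conj_chart k (origin, origin)) + 1"
    unfolding eventually_nhds_metric by blast
  \<comment> \<open>The distance in the product is at most the sum of the two distances, hence the
    radius \<open>d / 2\<close> in each variable.\<close>
  have "dist (x, y) (origin, origin) < d" if "x \<in> ball origin (d/2)" "y \<in> ball origin (d/2)" for x y
    using that norm_Pair_le[of "x - origin" "y - origin"] by (simp add: dist_norm norm_minus_commute)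
  then have near: "complex_differentiable2_at (conj_chart k) (x, y)"
    "norm (conj_chart k (x, y)) \<le> norm (conj_chart k (origin, origin)) + 1"
    if "x \<in> ball origin (d/2)" "y \<in> ball origin (d/2)" for x y
    using that d(2)[of "(x, y)"] by (auto simp del: mem_ball intro: less_imp_le)
  have "(\<lambda>x. frechet_derivative (\<lambda>y. conj_chart k (x, y)) (at origin) Y) differentiable (at origin)"
    by (rule differentiable_partial_derivative[where R = "d / 2", OF near]) (use d in auto)
  then have "(\<lambda>x. Ad (chart_inv k x) Y) differentiable (at origin)"
    by (simp add: conj_chart_def lie_Ad_def)
  then show ?thesis
    unfolding frechet_derivative_works lie_bracket_def by simp
qed

text \<open>First-order data of a one-parameter subgroup at 0. Convergence to \<open>\<one>\<close>
  is part of the definition because \<open>snd k\<close> is arbitrary outside \<open>fst k\<close>,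
  so the coordinate derivative alone would not place the curve in the chart.\<close>

definition tangent :: "(real \<Rightarrow> 'g) \<Rightarrow> complex^'n \<Rightarrow> bool" where
  "tangent \<gamma> X \<longleftrightarrow> (\<forall>t. \<gamma> t \<in> carrier G) \<and> \<gamma> 0 = \<one> \<and> (\<gamma> \<longlongrightarrow> \<one>) (nhds 0) \<and>
     ((\<lambda>t. snd k (\<gamma> t)) has_vector_derivative X) (at 0)"

text \<open>Chain rule in the chart; \<open>chart_inv k\<close> undoes \<open>snd k\<close> along
  the curve only for small \<open>t\<close>, which suffices for a derivative at 0.\<close>

lemma tangent_chain:
  assumes \<gamma>: "tangent \<gamma> X" and D: "((\<lambda>x. \<Phi> (chart_inv k x)) has_derivative D) (at origin)"
  shows "((\<lambda>t. \<Phi> (\<gamma> t)) has_vector_derivative D X) (at 0)"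
proof -
  have "((\<lambda>t. snd k (\<gamma> t)) has_derivative (\<lambda>t. t *\<^sub>R X)) (at 0)" "snd k (\<gamma> 0) = origin"
    using \<gamma> by (auto simp: tangent_def has_vector_derivative_def)
  from has_derivative_compose[OF this(1)] D this(2)
  have d: "((\<lambda>t. \<Phi> (chart_inv k (snd k (\<gamma> t)))) has_derivative (\<lambda>t. D (t *\<^sub>R X))) (at 0)"
    by simp
  have "\<forall>\<^sub>F t in nhds 0. \<gamma> t \<in> fst k"
    using \<gamma> eventually_in_chart[of \<gamma> \<one> "nhds 0" k] k one_k unfolding tangent_def by simp
  then have "\<forall>\<^sub>F t in nhds 0. \<Phi> (chart_inv k (snd k (\<gamma> t))) = \<Phi> (\<gamma> t)"
    by eventually_elim (simp add: chart_inv_chart k)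
  then have "\<forall>\<^sub>F t in at 0. \<Phi> (chart_inv k (snd k (\<gamma> t))) = \<Phi> (\<gamma> t)"
    "\<Phi> (chart_inv k (snd k (\<gamma> 0))) = \<Phi> (\<gamma> 0)"
    by (auto simp: eventually_nhds_conv_at)
  then have "((\<lambda>t. \<Phi> (\<gamma> t)) has_derivative (\<lambda>t. D (t *\<^sub>R X))) (at 0)"
    using has_derivative_transform_eventually[OF d] by simp
  then show ?thesis
    by (simp add: has_vector_derivative_def linear_scale[OF has_derivative_linear[OF D]])
qed

lemma Exp_props:
  shows "Exp X \<in> carrier G" "Exp ((s + t) *\<^sub>R X) = Exp (s *\<^sub>R X) \<otimes> Exp (t *\<^sub>R X)" "Exp 0 = \<one>"
    and Exp_tangent: "tangent (\<lambda>t. Exp (t *\<^sub>R X)) X"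
proof -
  have o: "one_parameter_subgroup G k X (\<lambda>t. Exp (t *\<^sub>R X))" for X
    using Exp by (simp add: is_lie_exp_def)
  have c: "Exp (t *\<^sub>R X) \<in> carrier G" for t X
    using o unfolding one_parameter_subgroup_def by blast
  show cl: "Exp X \<in> carrier G" for X using c[of 1] by simp
  show add: "Exp ((s + t) *\<^sub>R X) = Exp (s *\<^sub>R X) \<otimes> Exp (t *\<^sub>R X)" for s t
    using o unfolding one_parameter_subgroup_def by blast
  show zero: "Exp 0 = \<one>" using add[of 0 0] cl[of 0] by simp
  have "continuous_on UNIV (\<lambda>t. Exp (t *\<^sub>R X))"
    using o unfolding one_parameter_subgroup_def by blast
  then have "isCont (\<lambda>t. Exp (t *\<^sub>R X)) 0"
    by (simp add: continuous_on_eq_continuous_at)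
  then have "((\<lambda>t. Exp (t *\<^sub>R X)) \<longlongrightarrow> \<one>) (nhds 0)"
    using zero tendsto_at_iff_tendsto_nhds[of "\<lambda>t. Exp (t *\<^sub>R X)" 0] unfolding isCont_def by simp
  then show "tangent (\<lambda>t. Exp (t *\<^sub>R X)) X"
    using o[of X] c zero unfolding tangent_def one_parameter_subgroup_def by simp
qed

lemma tangent_conj:
  assumes "tangent \<gamma> X" "g \<in> carrier G"
  shows "tangent (\<lambda>t. g \<otimes> \<gamma> t \<otimes> inv g) (Ad g X)"
  unfolding tangent_def
proof (intro conjI allI)
  have \<gamma>: "\<And>t. \<gamma> t \<in> carrier G" "\<gamma> 0 = \<one>" "(\<gamma> \<longlongrightarrow> \<one>) (nhds 0)"
    using assms(1) by (auto simp: tangent_def)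
  have "((\<lambda>t. g \<otimes> \<gamma> t \<otimes> inv g) \<longlongrightarrow> g \<otimes> \<one> \<otimes> inv g) (nhds 0)"
    using \<gamma> assms(2) by (intro tendsto_mult tendsto_const) auto
  then show "((\<lambda>t. g \<otimes> \<gamma> t \<otimes> inv g) \<longlongrightarrow> \<one>) (nhds 0)" using assms(2) by simp
  show "((\<lambda>t. snd k (g \<otimes> \<gamma> t \<otimes> inv g)) has_vector_derivative Ad g X) (at 0)"
    by (rule tangent_chain[OF assms(1) Ad_derivative(1)[OF assms(2)]])
qed (use assms in \<open>auto simp: tangent_def\<close>)

section \<open>\<open>Ad\<close> as a representation by Lie algebra automorphisms\<close>

lemma tangent_derivative: "tangent \<gamma> X \<Longrightarrow> ((\<lambda>t. snd k (\<gamma> t)) has_vector_derivative X) (at 0)"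
  by (simp add: tangent_def)

lemma tangent_bracket:
  "tangent \<gamma> X \<Longrightarrow> ((\<lambda>t. Ad (\<gamma> t) Y) has_vector_derivative br X Y) (at 0)"
  using tangent_chain[OF _ bracket_derivative] .

text \<open>Conjugating \<open>exp (t X)\<close> by \<open>h\<close> and then by \<open>g\<close> is
  conjugating it by \<open>g \<otimes> h\<close>; both sides are the velocity of this one
  curve.\<close>

lemma Ad_mult:
  assumes "g \<in> carrier G" "h \<in> carrier G"
  shows "Ad (g \<otimes> h) X = Ad g (Ad h X)"
proof -
  let ?\<gamma> = "\<lambda>t. Exp (t *\<^sub>R X)"
  have "(\<lambda>t. snd k (g \<otimes> (h \<otimes> ?\<gamma> t \<otimes> inv h) \<otimes> inv g)) = (\<lambda>t. snd k ((g \<otimes> h) \<otimes> ?\<gamma> t \<otimes> inv (g \<otimes> h)))"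
    using assms Exp_props(1) by (simp add: inv_mult_group m_assoc)
  then show ?thesis
    using tangent_derivative[OF tangent_conj[OF tangent_conj[OF Exp_tangent[of X] assms(2)] assms(1)]]
      tangent_derivative[OF tangent_conj[OF Exp_tangent[of X] m_closed[OF assms]]]
      vector_derivative_unique_at by metis
qed

lemma Ad_one: "Ad \<one> X = X"
proof -
  have "(\<lambda>t. snd k (\<one> \<otimes> Exp (t *\<^sub>R X) \<otimes> inv \<one>)) = (\<lambda>t. snd k (Exp (t *\<^sub>R X)))"
    using Exp_props(1) by simp
  then show ?thesis
    using tangent_derivative[OF tangent_conj[OF Exp_tangent one_closed]]
      tangent_derivative[OF Exp_tangent] vector_derivative_unique_at by metis
qed

text \<open>Differentiate \<open>Ad g (Ad (exp (t X)) Y) = Ad (g exp (t X) (inv g)) (Ad g Y)\<close>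
  at \<open>t = 0\<close>.\<close>

lemma Ad_bracket:
  assumes "g \<in> carrier G"
  shows "Ad g (br X Y) = br (Ad g X) (Ad g Y)"
proof -
  let ?\<gamma> = "\<lambda>t. Exp (t *\<^sub>R X)"
  have "(\<lambda>t. Ad g (Ad (?\<gamma> t) Y)) = (\<lambda>t. Ad (g \<otimes> ?\<gamma> t \<otimes> inv g) (Ad g Y))"
    using assms Exp_props(1) by (simp add: Ad_mult[symmetric] m_assoc)
  moreover have "((\<lambda>t. Ad g (Ad (?\<gamma> t) Y)) has_vector_derivative Ad g (br X Y)) (at 0)"
    by (rule bounded_linear.has_vector_derivative[OF bounded_linear_Ad[OF assms] tangent_bracket[OF Exp_tangent]])
  ultimately show ?thesis
    using vector_derivative_unique_at[OF _ tangent_bracket[OF tangent_conj[OF Exp_tangent[of X] assms]]]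
    by simp
qed

section \<open>Bilinearity, antisymmetry and the Jacobi identity\<close>

lemma br_add_left: "br (X + X') Y = br X Y + br X' Y"
  using linear_add[OF has_derivative_linear[OF bracket_derivative]] .

lemma br_add_right: "br X (Y + Y') = br X Y + br X Y'"
proof -
  have "((\<lambda>t. Ad (Exp (t *\<^sub>R X)) Y + Ad (Exp (t *\<^sub>R X)) Y') has_vector_derivative br X Y + br X Y') (at 0)"
    by (intro has_vector_derivative_add tangent_bracket Exp_tangent)
  then show ?thesis
    using vector_derivative_unique_at[OF tangent_bracket[OF Exp_tangent[of X], of "Y + Y'"]]
    by (simp add: Ad_simps(1) Exp_props(1))
qed

lemma br_scale_right: "br X (z *s Y) = z *s br X Y"
proof -
  have "((\<lambda>t. z *s Ad (Exp (t *\<^sub>R X)) Y) has_vector_derivative z *s br X Y) (at 0)"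
    by (intro bounded_linear.has_vector_derivative[OF bounded_linear_vector_scale]
        tangent_bracket Exp_tangent)
  then show ?thesis
    using vector_derivative_unique_at[OF tangent_bracket[OF Exp_tangent[of X], of "z *s Y"]]
    by (simp add: Ad_simps(2) Exp_props(1))
qed

text \<open>\<open>exp (s X)\<close> commutes with \<open>exp (t X)\<close>, so \<open>Ad\<close> of the former fixes \<open>X\<close>.\<close>

lemma br_self: "br X X = 0"
proof -
  have "Ad (Exp (s *\<^sub>R X)) X = X" for s
  proof -
    have "Exp (s *\<^sub>R X) \<otimes> Exp (t *\<^sub>R X) \<otimes> inv (Exp (s *\<^sub>R X)) = Exp (t *\<^sub>R X)" for t
    proof -
      have "Exp (s *\<^sub>R X) \<otimes> Exp (t *\<^sub>R X) = Exp (t *\<^sub>R X) \<otimes> Exp (s *\<^sub>R X)"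
        using Exp_props(2)[of s t] Exp_props(2)[of t s] by (simp add: add.commute)
      then show ?thesis using Exp_props(1) by (simp add: m_assoc)
    qed
    then show ?thesis
      using tangent_derivative[OF tangent_conj[OF Exp_tangent[of X] Exp_props(1)[of "s *\<^sub>R X"]]]
        tangent_derivative[OF Exp_tangent[of X]] vector_derivative_unique_at by fastforce
  qed
  then have "((\<lambda>s::real. X) has_vector_derivative br X X) (at 0)"
    using tangent_bracket[OF Exp_tangent[of X], of X] by simp
  then show ?thesis using vector_derivative_unique_at has_vector_derivative_const by blast
qed

lemma br_antisym: "br X Y = - br Y X"
proof -
  have "br (X + Y) (X + Y) = br X Y + br Y X"
    unfolding br_add_left br_add_right by (simp add: br_self)
  then show ?thesis by (simp add: br_self eq_neg_iff_add_eq_0)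
qed

text \<open>As a derivative, the bracket is a priori only real linear in its first argument;
  antisymmetry transfers complex homogeneity from the second.\<close>

lemma br_scale_left: "br (z *s X) Y = z *s br X Y"
proof -
  have "br (z *s X) Y = - br Y (z *s X)" by (rule br_antisym)
  also have "\<dots> = z *s (- br Y X)" by (simp add: br_scale_right)
  also have "- br Y X = br X Y" by (rule br_antisym[symmetric])
  finally show ?thesis .
qed

lemma br_minus_right: "br X (- Y) = - br X Y" and br_minus_left: "br (- X) Y = - br X Y"
  using br_scale_right[of X "-1" Y] br_scale_left[of "-1" X Y] by simp_all

lemma br_zero: "br X 0 = 0" "br 0 X = 0"
  using br_scale_right[of X 0 0] br_scale_left[of 0 0 X] by auto

lemma bounded_bilinear_br: "bounded_bilinear br"
proof -
  have "bilinear br"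
    unfolding bilinear_def
    by (auto intro!: linearI simp: br_add_left br_add_right scaleR_vector br_scale_left br_scale_right)
  then show ?thesis by (simp add: bilinear_conv_bounded_bilinear)
qed

lemma jacobi: "br Z (br X Y) = br (br Z X) Y + br X (br Z Y)"
proof -
  let ?A = "\<lambda>t. Ad (Exp (t *\<^sub>R Z))"
  have "((\<lambda>t. br (?A t X) (?A t Y)) has_vector_derivative
      br (?A 0 X) (br Z Y) + br (br Z X) (?A 0 Y)) (at 0)"
    by (intro bounded_bilinear.has_vector_derivative[OF bounded_bilinear_br] tangent_bracket Exp_tangent)
  moreover have "(\<lambda>t. br (?A t X) (?A t Y)) = (\<lambda>t. ?A t (br X Y))"
    by (simp add: Ad_bracket Exp_props(1))
  ultimately show ?thesis
    using vector_derivative_unique_at[OF _ tangent_bracket[OF Exp_tangent[of Z], of "br X Y"]]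
    by (simp add: Exp_props(3) Ad_one add.commute)
qed

text \<open>Writing \<open>exp (s X) = exp ((s - t) X) exp (t X)\<close> moves the derivative at
  \<open>t\<close> to the derivative at 0.\<close>

lemma Ad_Exp_ode:
  "((\<lambda>t. Ad (Exp (t *\<^sub>R X)) Y) has_vector_derivative br X (Ad (Exp (t *\<^sub>R X)) Y)) (at t)"
proof -
  let ?u = "Ad (Exp (t *\<^sub>R X)) Y"
  have s: "((\<lambda>s. s - t) has_vector_derivative 1) (at t)"
    by (auto intro!: derivative_eq_intros)
  have "((\<lambda>s. Ad (Exp (s *\<^sub>R X)) ?u) has_vector_derivative br X ?u) (at (t - t))"
    using tangent_bracket[OF Exp_tangent] by simp
  from vector_diff_chain_at[OF s this]
  have "((\<lambda>s. Ad (Exp ((s - t) *\<^sub>R X)) ?u) has_vector_derivative br X ?u) (at t)"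
    by (simp add: o_def)
  moreover have "Ad (Exp ((s - t) *\<^sub>R X)) ?u = Ad (Exp (s *\<^sub>R X)) Y" for s
    using Exp_props(2)[of "s - t" t X] by (simp add: Ad_mult Exp_props(1))
  ultimately show ?thesis by simp
qed

section \<open>Lowest weight vectors\<close>

lemma br_sum_right: "br X (\<Sum>r\<in>S. F r) = (\<Sum>r\<in>S. br X (F r))"
  by (induction S rule: infinite_finite_induct) (auto simp: br_zero br_add_right)

context
  fixes e f h v :: "complex^'n" and m :: nat
  assumes ef: "br e f = h" and he: "br h e = 2 *s e"
    and fv: "br f v = 0" and hv: "br h v = - (of_nat m *s v)" and em: "(br e ^^ Suc m) v = 0"
begin

lemma lowest_weight_h: "br h ((br e ^^ r) v) = (2 * of_nat r - of_nat m) *s (br e ^^ r) v"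
proof (induction r)
  case 0
  then show ?case using hv by simp
next
  case (Suc r)
  have "br h ((br e ^^ Suc r) v) = br (br h e) ((br e ^^ r) v) + br e (br h ((br e ^^ r) v))"
    by (simp add: jacobi[of h])
  also have "\<dots> = (2 + (2 * of_nat r - of_nat m)) *s (br e ^^ Suc r) v"
    unfolding he Suc br_scale_left br_scale_right vec.scale_left_distrib by simp
  also have "2 + (2 * of_nat r - of_nat m) = 2 * of_nat (Suc r) - (of_nat m :: complex)" by simp
  finally show ?case .
qed

text \<open>Induction moves \<open>f\<close> past one \<open>e\<close>, at the cost of
  \<open>[f, e] = - h\<close>. At \<open>r = 0\<close> the truncated \<open>r - 1\<close> is
  harmless, since the coefficient vanishes.\<close>

lemma lowest_weight_f:
  "br f ((br e ^^ r) v) = (of_nat r * (of_nat m - of_nat r + 1)) *s (br e ^^ (r - 1)) v"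
proof (induction r)
  case 0
  then show ?case using fv by simp
next
  case (Suc r)
  have fe: "br f e = - h" using br_antisym[of f e] ef by simp
  have "br f ((br e ^^ Suc r) v) = br (br f e) ((br e ^^ r) v) + br e (br f ((br e ^^ r) v))"
    by (simp add: jacobi[of f])
  also have "br e (br f ((br e ^^ r) v)) = (of_nat r * (of_nat m - of_nat r + 1)) *s (br e ^^ r) v"
    unfolding Suc br_scale_right by (cases r) auto
  also have "br (br f e) ((br e ^^ r) v) = (of_nat m - 2 * of_nat r) *s (br e ^^ r) v"
    by (simp add: fe br_minus_left lowest_weight_h vec.scale_minus_left[symmetric] del: vec.scale_minus_left)
  also have "(of_nat m - 2 * of_nat r) *s (br e ^^ r) v + (of_nat r * (of_nat m - of_nat r + 1)) *s (br e ^^ r) v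
      = (of_nat (Suc r) * (of_nat m - of_nat (Suc r) + 1)) *s (br e ^^ r) v"
    unfolding vec.scale_left_distrib[symmetric] by (simp add: algebra_simps)
  finally show ?case by simp
qed

text \<open>In the model \<open>v = y\<^sup>m\<close> of homogeneous polynomials of degree \<open>m\<close>, \<open>exp (s (e + f))\<close> sends
  \<open>y\<close> to \<open>cosh s y + sinh s x\<close>; the curve \<open>u\<close> below is the expansion of the \<open>m\<close>-th power of this
  for \<open>s = \<i> \<pi> t / 2\<close>, with \<open>x\<^sup>r y\<^sup>m\<^sup>-\<^sup>r\<close> replaced by \<open>(m - r)! / m! ad\<^sub>e\<^sup>r v\<close>.\<close>

lemma Ad_Exp_lowest_weight:
  "Ad (Exp ((\<i> * of_real pi / 2) *s (e + f))) v = (\<i> ^ m / fact m) *s (br e ^^ m) v"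
proof -
  define \<kappa> where "\<kappa> = \<i> * of_real pi / 2"
  define w where "w = (\<lambda>r. (br e ^^ r) v)"
  \<comment> \<open>\<open>C\<close> and \<open>D\<close> are \<open>cosh (\<kappa> z)\<close> and
    \<open>sinh (\<kappa> z)\<close>.\<close>
  define C where "C = (\<lambda>z::complex. cos (of_real pi / 2 * z))"
  define D where "D = (\<lambda>z::complex. \<i> * sin (of_real pi / 2 * z))"
  \<comment> \<open>The factor \<open>1 / fact r\<close> is the binomial coefficient times
    \<open>(m - r)! / m!\<close>.\<close>
  define p where "p = (\<lambda>r z. C z ^ (m - r) * D z ^ r / fact r)"
  \<comment> \<open>The derivative of \<open>p r\<close>. Where an exponent truncates at 0, the
    factor \<open>of_nat r\<close> or \<open>of_nat (m - r)\<close> is 0.\<close>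
  define p' where "p' = (\<lambda>r z. \<kappa> * (of_nat r * C z ^ (m - r + 1) * D z ^ (r - 1) +
    of_nat (m - r) * C z ^ (m - Suc r) * D z ^ Suc r) / fact r)"
  define u where "u = (\<lambda>t::real. \<Sum>r\<le>m. p r (of_real t) *s w r)"
  have C': "(C has_field_derivative \<kappa> * D z) (at z)" for z
    unfolding C_def D_def \<kappa>_def by (auto intro!: derivative_eq_intros simp: algebra_simps)
  have D': "(D has_field_derivative \<kappa> * C z) (at z)" for z
    unfolding C_def D_def \<kappa>_def by (auto intro!: derivative_eq_intros simp: algebra_simps)
  have "(p r has_field_derivative p' r z) (at z)" for r z
  proof -
    have "((\<lambda>z. C z ^ (m - r) * D z ^ r) has_field_derivative \<kappa> * (of_nat r * C z ^ (m - r + 1) * D z ^ (r - 1) +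
        of_nat (m - r) * C z ^ (m - Suc r) * D z ^ Suc r)) (at z)"
      by (rule derivative_eq_intros C' D' refl)+ (simp add: algebra_simps)
    then show ?thesis unfolding p_def p'_def by (rule DERIV_cdivide)
  qed
  then have pv: "((\<lambda>t. p r (of_real t)) has_vector_derivative p' r (of_real t)) (at t)" for r t
    by (rule has_vector_derivative_real_field)
  have "br (\<kappa> *s (e + f)) (u t) = (\<Sum>r\<le>m. p' r (of_real t) *s w r)" for t
  proof -
    let ?z = "complex_of_real t"
    \<comment> \<open>The contribution of \<open>e\<close> is the sum of \<open>g (Suc r)\<close>,
      that of \<open>f\<close> the sum of \<open>g' r\<close>. Shifting the index turns them into
      the two halves of \<open>p'\<close>; the boundary terms vanish because \<open>g 0\<close>,
      \<open>g' 0\<close> and \<open>g' (Suc m)\<close> have coefficient 0 and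
      \<open>w (Suc m) = 0\<close>.\<close>
    define g where "g = (\<lambda>r. (of_nat r * C ?z ^ (m - r + 1) * D ?z ^ (r - 1) / fact r) *s w r)"
    define g' where "g' = (\<lambda>r. (p r ?z * (of_nat r * (of_nat m - of_nat r + 1))) *s w (r - 1))"
    have w: "w (Suc m) = 0" using em by (simp add: w_def)
    have "(\<Sum>r\<le>m. g (Suc r)) = (\<Sum>r\<le>m. g r)"
      using sum.atMost_Suc_shift[of g m] w by (simp add: g_def)
    moreover have "p r ?z *s w (Suc r) = g (Suc r)" if "r \<le> m" for r
    \<comment> \<open>At \<open>r = m\<close> the exponent \<open>m - Suc r + 1\<close> is 1 instead
      of 0, but both sides vanish with \<open>w (Suc m)\<close>.\<close>
    proof (cases "r = m")
      case False
      then have "m - r = m - Suc r + 1" using that by simp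
      then show ?thesis by (simp add: g_def p_def del: of_nat_Suc)
    qed (simp add: g_def w)
    ultimately have 1: "(\<Sum>r\<le>m. p r ?z *s w (Suc r)) = (\<Sum>r\<le>m. g r)"
      by (metis (no_types, lifting) atMost_iff sum.cong)
    have 2: "(\<Sum>r\<le>m. g' r) = (\<Sum>r\<le>m. g' (Suc r))"
      using sum.atMost_Suc_shift[of g' m] by (simp add: g'_def)
    have 3: "g' (Suc r) = (of_nat (m - r) * C ?z ^ (m - Suc r) * D ?z ^ Suc r / fact r) *s w r"
      if "r \<le> m" for r
    proof -
      have "of_nat m - of_nat (Suc r) + 1 = (of_nat (m - r) :: complex)" using that by simp
      then show ?thesis
        by (simp add: g'_def p_def field_simps del: of_nat_Suc of_nat_diff)
    qed
    have 4: "br (e + f) (w r) = w (Suc r) + (of_nat r * (of_nat m - of_nat r + 1)) *s w (r - 1)" for r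
      by (simp add: w_def br_add_left lowest_weight_f)
    have "br (\<kappa> *s (e + f)) (u t) = \<kappa> *s (\<Sum>r\<le>m. p r ?z *s
        (w (Suc r) + (of_nat r * (of_nat m - of_nat r + 1)) *s w (r - 1)))"
      unfolding u_def br_scale_left br_sum_right br_scale_right vec.scale_sum_right 4
      by (simp only: vector_smult_assoc mult.commute)
    also have "(\<Sum>r\<le>m. p r ?z *s (w (Suc r) + (of_nat r * (of_nat m - of_nat r + 1)) *s w (r - 1)))
        = (\<Sum>r\<le>m. p r ?z *s w (Suc r)) + (\<Sum>r\<le>m. g' r)"
      unfolding g'_def by (simp add: vector_add_ldistrib vector_smult_assoc sum.distrib)
    also have "\<dots> = (\<Sum>r\<le>m. g r + g' (Suc r))" unfolding 1 2 sum.distrib ..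
    also have "\<kappa> *s \<dots> = (\<Sum>r\<le>m. p' r ?z *s w r)"
      unfolding vec.scale_sum_right
    proof (rule sum.cong[OF refl])
      fix r assume "r \<in> {..m}"
      then have "r \<le> m" by simp
      show "\<kappa> *s (g r + g' (Suc r)) = p' r ?z *s w r"
        unfolding 3[OF \<open>r \<le> m\<close>] g_def p'_def vec.scale_left_distrib[symmetric] vector_smult_assoc
        by (simp add: add_divide_distrib distrib_left)
    qed
    finally show ?thesis .
  qed
  then have u: "(u has_vector_derivative br (\<kappa> *s (e + f)) (u t)) (at t)" for t
    unfolding u_def
    by (auto intro!: has_vector_derivative_sum
        bounded_linear.has_vector_derivative[OF bounded_linear_vector_scalar_mult] pv)
  have "p r 0 *s w r = (if r = 0 then v else 0)" for r
    by (simp add: p_def C_def D_def w_def)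
  then have u0: "u 0 = v" by (simp add: u_def)
  \<comment> \<open>At \<open>t = 1\<close> one has \<open>C = 0\<close> and
    \<open>D = \<i>\<close>, so only the term without a factor \<open>C\<close> survives.\<close>
  have "p r 1 *s w r = (if r = m then (\<i> ^ m / fact m) *s w m else 0)" if "r \<le> m" for r
    using that by (simp add: p_def C_def D_def cos_of_real[of "pi / 2", simplified]
        sin_of_real[of "pi / 2", simplified])
  then have "u 1 = (\<Sum>r\<le>m. if r = m then (\<i> ^ m / fact m) *s w m else 0)"
    unfolding u_def by (intro sum.cong) auto
  then have u1: "u 1 = (\<i> ^ m / fact m) *s w m" by simp
  have "Ad (Exp (1 *\<^sub>R (\<kappa> *s (e + f)))) v = u 1"
    by (rule linear_ode_unique[where u = "\<lambda>t. Ad (Exp (t *\<^sub>R (\<kappa> *s (e + f)))) v", OF _ _ _ Ad_Exp_ode u])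
      (simp_all add: bounded_bilinear.bounded_linear_right[OF bounded_bilinear_br] u0 Exp_props(3) Ad_one)
  then show ?thesis by (simp add: u1 \<kappa>_def w_def)
qed

end

lemma funpow_br_scale: "(br (z *s X) ^^ m) (z' *s Y) = (z ^ m * z') *s (br X ^^ m) Y"
  by (induction m) (auto simp: br_scale_left br_scale_right vector_smult_assoc)

text \<open>\<open>F\<close> maps the curve \<open>g exp (t X) (inv g)\<close> to the conjugate of
  \<open>F (exp (t X))\<close> by \<open>F g\<close>; the two computations of its velocity agree.
  \<open>D\<close> enters as a real derivative, so the antilinear \<open>cj\<close> is
  covered.\<close>

lemma Ad_integrated_automorphism:
  assumes "integrates_automorphism G k D F" and g: "g \<in> carrier G"
  shows "Ad (F g) (D X) = D (Ad g X)"
proof -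
  let ?\<gamma> = "\<lambda>t. Exp (t *\<^sub>R X)"
  have F: "F \<in> hom G G" "continuous_on (carrier G) F"
    "((\<lambda>x. snd k (F (chart_inv k x))) has_derivative D) (at origin)"
    using assms(1) unfolding integrates_automorphism_def iso_def differential_at_one_def by auto
  have Fc: "F x \<in> carrier G" if "x \<in> carrier G" for x using F(1) that by (rule hom_in_carrier)
  have F1: "F \<one> = \<one>" using hom_one[OF F(1)] is_group by simp
  have \<gamma>: "?\<gamma> t \<in> carrier G" for t by (rule Exp_props)
  have tF: "tangent (\<lambda>t. F (?\<gamma> t)) (D X)"
    unfolding tangent_def
  proof (intro conjI allI)
    have "((\<lambda>t. F (?\<gamma> t)) \<longlongrightarrow> F \<one>) (nhds 0)"
      using Exp_tangent[of X] \<gamma> unfolding tangent_def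
      by (intro continuous_on_tendsto_compose[OF F(2)]) auto
    then show "((\<lambda>t. F (?\<gamma> t)) \<longlongrightarrow> \<one>) (nhds 0)" using F1 by simp
    show "((\<lambda>t. snd k (F (?\<gamma> t))) has_vector_derivative D X) (at 0)"
      by (rule tangent_chain[OF Exp_tangent F(3)])
  qed (use Fc \<gamma> F1 in \<open>auto simp: Exp_props(3)\<close>)
  have "inv F g = F (inv g)"
    using group_hom.hom_inv[of G G F g] F(1) g is_group
    by (simp add: group_hom_def group_hom_axioms_def)
  then have "(\<lambda>t. snd k (F g \<otimes> F (?\<gamma> t) \<otimes> inv (F g))) = (\<lambda>t. snd k (F (g \<otimes> ?\<gamma> t \<otimes> inv g)))"
    using F(1) g \<gamma> by (simp add: hom_mult)
  then show ?thesis
    using vector_derivative_unique_at[OF tangent_derivative[OF tangent_conj[OF tF Fc[OF g]]]]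
      tangent_chain[OF tangent_conj[OF Exp_tangent[of X] g] F(3)] by simp
qed

end

section \<open>Groups given by generators and relations\<close>

lemma word_equiv_append:
  assumes "word_equiv R u u'" "word_equiv R v v'"
  shows "word_equiv R (u @ v) (u' @ v')"
  using we_context[OF assms(1), of "[]" v] we_context[OF assms(2), of u' "[]"]
  by (auto intro: we_trans)

lemma word_class_eq_iff: "word_class R u = word_class R v \<longleftrightarrow> word_equiv R u v"
  unfolding word_class_def by (auto intro: we_refl we_sym we_trans)

text \<open>Equivalence is a congruence for concatenation, so the setwise product is the class of
  any concatenation of representatives.\<close>

lemma presented_group_mult:
  "word_class R u \<otimes>\<^bsub>presented_group R\<^esub> word_class R v = word_class R (u @ v)"
  unfolding presented_group_def word_class_def
  by (auto intro: we_refl we_trans word_equiv_append)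

text \<open>The two letters meeting in the middle cancel, and induction removes the rest.\<close>

lemma word_equiv_inverse:
  "word_equiv R (rev (map (\<lambda>(s, b). (s, \<not> b)) u) @ u) []"
proof (induction u)
  case (Cons x u)
  obtain s b where x: "x = (s, b)" by (cases x)
  have "word_equiv R [(s, \<not> b), (s, b)] []" using we_cancel[of R s "\<not> b"] by simp
  from we_context[OF this, of "rev (map (\<lambda>(s, b). (s, \<not> b)) u)" u] Cons show ?case
    by (auto simp: x intro: we_trans)
qed (simp add: we_refl)

lemma group_presented_group: "group (presented_group R)"
proof (rule groupI)
  show "\<one>\<^bsub>presented_group R\<^esub> \<in> carrier (presented_group R)" by (simp add: presented_group_def)
next
  fix x y assume "x \<in> carrier (presented_group R)" "y \<in> carrier (presented_group R)"
  then obtain u v where "x = word_class R u" "y = word_class R v"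
    by (auto simp: presented_group_def)
  then have "x \<otimes>\<^bsub>presented_group R\<^esub> y = word_class R (u @ v)" by (simp add: presented_group_mult)
  then show "x \<otimes>\<^bsub>presented_group R\<^esub> y \<in> carrier (presented_group R)"
    by (simp add: presented_group_def)
next
  fix x y z
  assume "x \<in> carrier (presented_group R)" "y \<in> carrier (presented_group R)"
    "z \<in> carrier (presented_group R)"
  then obtain u v w where "x = word_class R u" "y = word_class R v" "z = word_class R w"
    by (auto simp: presented_group_def)
  then show "x \<otimes>\<^bsub>presented_group R\<^esub> y \<otimes>\<^bsub>presented_group R\<^esub> z
      = x \<otimes>\<^bsub>presented_group R\<^esub> (y \<otimes>\<^bsub>presented_group R\<^esub> z)"
    by (simp add: presented_group_mult)
next
  fix x assume "x \<in> carrier (presented_group R)"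
  then obtain u where u: "x = word_class R u" by (auto simp: presented_group_def)
  have one: "\<one>\<^bsub>presented_group R\<^esub> = word_class R []" by (simp add: presented_group_def)
  show "\<one>\<^bsub>presented_group R\<^esub> \<otimes>\<^bsub>presented_group R\<^esub> x = x"
    by (simp add: u one presented_group_mult)
  have "word_class R (rev (map (\<lambda>(s, b). (s, \<not> b)) u)) \<otimes>\<^bsub>presented_group R\<^esub> x = \<one>\<^bsub>presented_group R\<^esub>"
    unfolding u one presented_group_mult word_class_eq_iff by (rule word_equiv_inverse)
  then show "\<exists>y\<in>carrier (presented_group R). y \<otimes>\<^bsub>presented_group R\<^esub> x = \<one>\<^bsub>presented_group R\<^esub>"
    by (auto simp: presented_group_def)
qed

text \<open>Ensures that \<open>galois_act\<close>, which tests for equality with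
  \<open>cnj\<close>, is trivial on \<open>id\<close>.\<close>

lemma cnj_neq_id: "cnj \<noteq> id"
proof
  assume "cnj = id"
  then have "cnj \<i> = \<i>" by simp
  then show False by (simp add: complex_eq_iff)
qed

text \<open>The fixed points of the square of \<open>cj\<close> form a complex subspace, since
  scalars are conjugated twice. It is closed under the bracket and contains the generators.\<close>

lemma split_conjugation_involution:
  assumes gen: "chevalley_serre_generators br a h e f" and cj: "split_conjugation br h e f cj"
  shows "cj (cj X) = X"
proof -
  have anti: "cj (x + y) = cj x + cj y" "cj (z *s x) = cnj z *s cj x" "cj (br x y) = br (cj x) (cj y)"
    for x y z
    using cj unfolding split_conjugation_def antilinear_def by blast+
  have "vec.subspace {X. cj (cj X) = X}"
    using anti(2)[of 0 0] by (simp add: vec.subspace_def anti)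
  moreover have "range h \<union> range e \<union> range f \<subseteq> {X. cj (cj X) = X}"
    using cj by (auto simp: split_conjugation_def)
  ultimately have "{X. cj (cj X) = X} = UNIV"
    using gen anti(3) unfolding chevalley_serre_generators_def by auto
  then show ?thesis by auto
qed

section \<open>The action on the Chevalley--Serre generators\<close>

context lie_chart
begin

context
  fixes a :: "'i::finite \<Rightarrow> 'i \<Rightarrow> int" and h e f :: "'i \<Rightarrow> complex^'n"
    and cj :: "complex^'n \<Rightarrow> complex^'n" and cjG :: "'g \<Rightarrow> 'g"
  assumes cartan: "cartan_matrix a" and gen: "chevalley_serre_generators br a h e f"
    and conj: "split_conjugation br h e f cj"
begin

lemma generator_relations:
  "br (h i) (e j) = of_int (a i j) *s e j" "br (h i) (f j) = - (of_int (a i j) *s f j)"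
  "br (e i) (f i) = h i" "i \<noteq> j \<Longrightarrow> br (e i) (f j) = 0"
  "i \<noteq> j \<Longrightarrow> (br (e i) ^^ nat (1 - a i j)) (e j) = 0"
  "i \<noteq> j \<Longrightarrow> (br (f i) ^^ nat (1 - a i j)) (f j) = 0"
  using gen unfolding chevalley_serre_generators_def by auto

lemma cartan_entries: "a i i = 2" "i \<noteq> j \<Longrightarrow> a i j \<le> 0"
  using cartan unfolding cartan_matrix_def by auto

lemma br_fe: "br (f i) (e i) = - h i" "i \<noteq> j \<Longrightarrow> br (f i) (e j) = 0"
  using br_antisym[of "f i" "e i"] br_antisym[of "f i" "e j"] by (auto simp: generator_relations)

section \<open>Half turns on the generators\<close>

abbreviation "half_turn i \<equiv> Exp ((\<i> * of_real pi / 2) *s (e i + f i))"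

lemma Ad_half_turn_same: "Ad (half_turn i) (e i) = f i" "Ad (half_turn i) (f i) = e i"
proof -
  have eh: "br (e i) (h i) = - (2 *s e i)" "br (f i) (h i) = 2 *s f i"
    using br_antisym[of "e i" "h i"] br_antisym[of "f i" "h i"]
    by (auto simp: generator_relations cartan_entries)
  \<comment> \<open>\<open>f i\<close> has weight -2, and two brackets with \<open>e i\<close> send
    it to \<open>- 2 e i\<close>, which cancels \<open>\<i>^2 / 2! = - 1 / 2\<close>.\<close>
  have "Ad (half_turn i) (f i) = (\<i> ^ 2 / fact 2) *s (br (e i) ^^ 2) (f i)"
    by (rule Ad_Exp_lowest_weight)
      (auto simp: generator_relations cartan_entries br_self eh numeral_2_eq_2 br_scale_right br_minus_right br_zero)
  then show "Ad (half_turn i) (f i) = e i"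
    by (simp add: generator_relations eh numeral_2_eq_2 br_minus_right br_scale_right)
  have "Ad (half_turn i) (e i) = (\<i> ^ 2 / fact 2) *s (br (f i) ^^ 2) (e i)"
    \<comment> \<open>Swapping the summands exposes the opposite triple
      \<open>(f i, e i, - h i)\<close>.\<close>
    unfolding add.commute[of "e i"]
    by (rule Ad_Exp_lowest_weight)
      (auto simp: generator_relations br_fe cartan_entries br_self eh numeral_2_eq_2 br_scale_right
        br_minus_right br_minus_left br_zero)
  then show "Ad (half_turn i) (e i) = f i"
    by (simp add: br_fe eh numeral_2_eq_2 br_minus_right br_scale_right)
qed

lemma Ad_half_turn_other:
  assumes "i \<noteq> j"
  defines "m \<equiv> nat \<bar>a i j\<bar>"
  shows "Ad (half_turn i) (e j) = (\<i> ^ m / fact m) *s (br (e i) ^^ m) (e j)"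
    "Ad (half_turn i) (f j) = (\<i> ^ m / fact m) *s (br (f i) ^^ m) (f j)"
proof -
  \<comment> \<open>As \<open>a i j \<le> 0\<close>, the Serre exponent is one more than
    \<open>m\<close>, and \<open>e j\<close> has weight \<open>- m\<close>.\<close>
  have m: "nat (1 - a i j) = Suc m" "of_int (a i j) = - (of_nat m :: complex)"
    using cartan_entries(2)[OF assms(1)] by (auto simp: m_def nat_diff_distrib)
  show "Ad (half_turn i) (e j) = (\<i> ^ m / fact m) *s (br (e i) ^^ m) (e j)"
    using generator_relations(5)[OF assms(1)] assms(1)
    by (intro Ad_Exp_lowest_weight) (auto simp: generator_relations br_fe cartan_entries m)
  show "Ad (half_turn i) (f j) = (\<i> ^ m / fact m) *s (br (f i) ^^ m) (f j)"
    unfolding add.commute[of "e i"]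
    using generator_relations(6)[OF assms(1)] assms(1)
    by (intro Ad_Exp_lowest_weight)
      (auto simp: generator_relations br_fe cartan_entries m br_minus_left)
qed

text \<open>Conjugation acts first and changes \<open>\<i>\<close> to \<open>- \<i>\<close>; this
  scalar then passes through the complex linear \<open>Ad\<close>.\<close>

lemma Ad_varsigma:
  "Ad_tilde G k cj (varsigma Exp e f i) (\<i> *s e j) = - (\<i> *s Ad (half_turn i) (e j))"
  "Ad_tilde G k cj (varsigma Exp e f i) (\<i> *s f j) = - (\<i> *s Ad (half_turn i) (f j))"
proof -
  have "cj (\<i> *s e j) = - \<i> *s e j" "cj (\<i> *s f j) = - \<i> *s f j"
    using conj by (auto simp: split_conjugation_def antilinear_def)
  then show "Ad_tilde G k cj (varsigma Exp e f i) (\<i> *s e j) = - (\<i> *s Ad (half_turn i) (e j))"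
    "Ad_tilde G k cj (varsigma Exp e f i) (\<i> *s f j) = - (\<i> *s Ad (half_turn i) (f j))"
    using Ad_simps(2)[OF Exp_props(1)[of "(\<i> * of_real pi / 2) *s (e i + f i)"], of "- \<i>"]
    by (simp_all add: Ad_tilde_def varsigma_def galois_act_def del: vector_add_ldistrib)
qed

lemma Ad_varsigma_same:
  "Ad_tilde G k cj (varsigma Exp e f i) (\<i> *s e i) = - (\<i> *s f i)"
  "Ad_tilde G k cj (varsigma Exp e f i) (\<i> *s f i) = - (\<i> *s e i)"
  unfolding Ad_varsigma Ad_half_turn_same by (rule refl)+

text \<open>The power \<open>\<i> ^ m\<close> from the half turn and the scalar of
  \<open>\<i> e j\<close> are exactly the factors distributed over the iterated bracket.\<close>

lemma Ad_varsigma_other: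
  assumes "i \<noteq> j"
  shows "Ad_tilde G k cj (varsigma Exp e f i) (\<i> *s e j) =
      - ((1 / fact (nat \<bar>a i j\<bar>)) *s (br (\<i> *s e i) ^^ nat \<bar>a i j\<bar>) (\<i> *s e j))"
    "Ad_tilde G k cj (varsigma Exp e f i) (\<i> *s f j) =
      - ((1 / fact (nat \<bar>a i j\<bar>)) *s (br (\<i> *s f i) ^^ nat \<bar>a i j\<bar>) (\<i> *s f j))"
  unfolding Ad_varsigma Ad_half_turn_other[OF assms] funpow_br_scale vector_smult_assoc
  by (simp_all add: mult.commute)

section \<open>The action of the semidirect product\<close>

lemma cj_cj: "cj (cj X) = X"
  by (rule split_conjugation_involution[OF gen conj])

text \<open>Linearity is over the reals, because the Galois generator acts antilinearly.\<close>

lemma linear_Ad_tilde: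
  assumes "g \<in> carrier G" "s \<in> {id, cnj}"
  shows "linear (Ad_tilde G k cj (g, s))"
proof -
  have "linear cj"
    using conj by (auto intro!: linearI simp: split_conjugation_def antilinear_def scaleR_vector)
  then have "linear (galois_act cj s)"
    by (auto simp: galois_act_def linear_id[unfolded id_def] id_def)
  then show ?thesis
    using bounded_linear.linear[OF bounded_linear_Ad[OF assms(1)]]
    by (simp add: Ad_tilde_def linear_compose)
qed

text \<open>The twist in the semidirect product matches the rule that moving \<open>cj\<close> past
  \<open>Ad g'\<close> turns it into \<open>Ad (cjG g')\<close>.\<close>

lemma Ad_tilde_mult:
  assumes int: "integrates_automorphism G k cj cjG"
    and "g \<in> carrier G" "g' \<in> carrier G" "s \<in> {id, cnj}" "t \<in> {id, cnj}"
  shows "Ad_tilde G k cj (g \<otimes> galois_act cjG s g', s \<circ> t)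
    = Ad_tilde G k cj (g, s) \<circ> Ad_tilde G k cj (g', t)"
proof
  fix X
  have c: "cjG g' \<in> carrier G"
    using int assms(3) unfolding integrates_automorphism_def iso_def by (auto intro: hom_in_carrier)
  have "cnj \<circ> cnj = id" by auto
  then show "Ad_tilde G k cj (g \<otimes> galois_act cjG s g', s \<circ> t) X
      = (Ad_tilde G k cj (g, s) \<circ> Ad_tilde G k cj (g', t)) X"
    using assms c Ad_integrated_automorphism[OF int assms(3), of X]
      Ad_integrated_automorphism[OF int assms(3), of "cj X"] cnj_neq_id
    by (auto simp: Ad_tilde_def galois_act_def Ad_mult cj_cj)
qed

text \<open>Each element acts bijectively, and \<open>Ad_tilde_mult\<close> turns
  \<open>\<phi>\<close> into a homomorphism to the permutations of the Lie algebra.\<close>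

lemma group_action_Ad_tilde:
  assumes int: "integrates_automorphism G k cj cjG" and H: "group H"
    and \<phi>: "\<phi> \<in> hom H (galois_semidirect (compact_form G cjG tpG) cjG)"
  shows "group_action H UNIV (\<lambda>w. Ad_tilde G k cj (\<phi> w))"
    and "w \<in> carrier H \<Longrightarrow> linear (Ad_tilde G k cj (\<phi> w))"
proof -
  interpret H: group H by (rule H)
  let ?T = "\<lambda>w. Ad_tilde G k cj (\<phi> w)"
  have c: "fst (\<phi> w) \<in> carrier G" "snd (\<phi> w) \<in> {id, cnj}" if "w \<in> carrier H" for w
    using hom_in_carrier[OF \<phi> that] by (auto simp: galois_semidirect_def compact_form_def)
  have mult: "?T (x \<otimes>\<^bsub>H\<^esub> y) = ?T x \<circ> ?T y" if "x \<in> carrier H" "y \<in> carrier H" for x y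
  proof -
    have "\<phi> (x \<otimes>\<^bsub>H\<^esub> y) = (fst (\<phi> x) \<otimes> galois_act cjG (snd (\<phi> x)) (fst (\<phi> y)), snd (\<phi> x) \<circ> snd (\<phi> y))"
      using hom_mult[OF \<phi> that]
      by (simp add: galois_semidirect_def compact_form_def case_prod_unfold)
    then show ?thesis
      using Ad_tilde_mult[OF int c(1)[OF that(1)] c(1)[OF that(2)] c(2)[OF that(1)] c(2)[OF that(2)]]
      by simp
  qed
  show "linear (?T w)" if "w \<in> carrier H" for w
    using linear_Ad_tilde[OF c[OF that]] by simp
  have inj: "inj (?T w)" if "w \<in> carrier H" for w
  proof -
    have "inj (lie_Ad G k (fst (\<phi> w)))"
      using c(1)[OF that] by (intro inj_on_inverseI[of _ "Ad (inv (fst (\<phi> w)))"])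
        (simp add: Ad_mult[symmetric] Ad_one)
    moreover have "inj (galois_act cj (snd (\<phi> w)))"
      using cj_cj by (auto simp: galois_act_def intro: inj_on_inverseI[of _ cj])
    ultimately show ?thesis unfolding Ad_tilde_def by (rule inj_compose)
  qed
  \<comment> \<open>An injective idempotent map is the identity.\<close>
  have one: "?T \<one>\<^bsub>H\<^esub> = id"
    using mult[of "\<one>\<^bsub>H\<^esub>" "\<one>\<^bsub>H\<^esub>"] inj[of "\<one>\<^bsub>H\<^esub>"] by (auto simp: fun_eq_iff inj_eq)
  have surj: "surj (?T w)" if "w \<in> carrier H" for w
    using mult[of w "inv\<^bsub>H\<^esub> w"] that one by (metis H.inv_closed H.r_inv comp_apply id_apply surjI)
  have bij: "?T w \<in> carrier (BijGroup UNIV)" if "w \<in> carrier H" for w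
    using inj surj that by (simp add: BijGroup_def Bij_def bij_def extensional_def)
  have "?T \<in> hom H (BijGroup UNIV)"
  proof (rule homI[OF bij])
    show "?T (x \<otimes>\<^bsub>H\<^esub> y) = ?T x \<otimes>\<^bsub>BijGroup UNIV\<^esub> ?T y" if "x \<in> carrier H" "y \<in> carrier H" for x y
      using mult[OF that] bij[OF that(1)] bij[OF that(2)]
      by (simp add: BijGroup_def compose_def fun_eq_iff)
  qed
  then show "group_action H UNIV ?T"
    using H group_BijGroup by (simp add: group_action_def group_hom_def group_hom_axioms_def)
qed

end

end

theorem proposition5p2:
  fixes G :: "('g::t2_space) monoid"
    and A :: "('g, 'n::finite) chart set" and k :: "('g, 'n) chart"
    and a :: "'i::finite \<Rightarrow> 'i \<Rightarrow> int"
    and h e f :: "'i \<Rightarrow> complex^'n"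
    and Exp :: "complex^'n \<Rightarrow> 'g"
    and cj tp :: "complex^'n \<Rightarrow> complex^'n"
    and cjG tpG :: "'g \<Rightarrow> 'g"
  assumes "complex_lie_group G A"
    and "k \<in> A" and "\<one>\<^bsub>G\<^esub> \<in> fst k"
    and "connected (carrier G)" and "simply_connected (carrier G)"
    and "semisimple_bracket (lie_bracket G k)"
    and "cartan_matrix a"
    and "chevalley_serre_generators (lie_bracket G k) a h e f"
    and "is_lie_exp G k Exp"
    and "split_conjugation (lie_bracket G k) h e f cj"
    and "integrates_automorphism G k cj cjG"
    and "cartan_anti_involution (lie_bracket G k) h e f tp"
    and "integrates_anti_automorphism G k tp tpG"
  shows
    "(\<forall>\<phi> \<in> hom (WGU a) (galois_semidirect (compact_form G cjG tpG) cjG).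
        (\<forall>i. \<phi> (wgu_gen a (Sig i)) = varsigma Exp e f i \<and>
             \<phi> (wgu_gen a (SigBar i)) = varsigma_bar Exp e f i) \<longrightarrow>
        group_action (WGU a) UNIV (\<lambda>w. Ad_tilde G k cj (\<phi> w)) \<and>
        (\<forall>w \<in> carrier (WGU a). linear (Ad_tilde G k cj (\<phi> w))))
     \<and> (\<forall>i. Ad_tilde G k cj (varsigma Exp e f i) (\<i> *s e i) = - (\<i> *s f i) \<and>
            Ad_tilde G k cj (varsigma Exp e f i) (\<i> *s f i) = - (\<i> *s e i))
     \<and> (\<forall>i j. a i j = 0 \<longrightarrow>
            Ad_tilde G k cj (varsigma Exp e f i) (\<i> *s e j) = - (\<i> *s e j) \<and>
            Ad_tilde G k cj (varsigma Exp e f i) (\<i> *s f j) = - (\<i> *s f j))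
     \<and> (\<forall>i j. i \<noteq> j \<longrightarrow>
            Ad_tilde G k cj (varsigma Exp e f i) (\<i> *s e j) =
              - ((1 / fact (nat \<bar>a i j\<bar>)) *s
                 (lie_bracket G k (\<i> *s e i) ^^ nat \<bar>a i j\<bar>) (\<i> *s e j)) \<and>
            Ad_tilde G k cj (varsigma Exp e f i) (\<i> *s f j) =
              - ((1 / fact (nat \<bar>a i j\<bar>)) *s
                 (lie_bracket G k (\<i> *s f i) ^^ nat \<bar>a i j\<bar>) (\<i> *s f j)))"
proof -
  interpret lie_chart G A k Exp by unfold_locales (use assms in auto)
  note setting = assms(7,8,10)
  \<comment> \<open>The diagonal entries are 2, so \<open>a i j = 0\<close> falls under the formula
    for distinct indices, with no bracket and \<open>fact 0 = 1\<close>.\<close>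
  have ne: "i \<noteq> j" if "a i j = 0" for i j
    using that cartan_entries(1)[OF setting, of i] by auto
  show ?thesis
  proof (intro conjI ballI allI impI)
    fix \<phi> assume \<phi>: "\<phi> \<in> hom (WGU a) (galois_semidirect (compact_form G cjG tpG) cjG)"
    have W: "group (WGU a)" unfolding WGU_def by (rule group_presented_group)
    show "group_action (WGU a) UNIV (\<lambda>w. Ad_tilde G k cj (\<phi> w))"
      and "\<And>w. w \<in> carrier (WGU a) \<Longrightarrow> linear (Ad_tilde G k cj (\<phi> w))"
      using group_action_Ad_tilde[OF setting assms(11) W \<phi>] by auto
  qed (use Ad_varsigma_same[OF setting] Ad_varsigma_other[OF setting] ne in auto)
qed

end
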